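(* Every $g\in\mathbb{G}$ is equal to a finite composition of maps each of which is one of $g_{0,+}$, $g_{0,-}$, $\bar{w}_{3,[\frac14,\frac12]}$, $w_{2,[\frac34,1]}$, $w_{2,[0,1]}$, or one of the two generator maps $f_A,f_B$ of Thompson's group $\mathbb{F}$ or their inverses $f_A^{-1},f_B^{-1}$.
   Context: $\lambda$ is Lebesgue measure on $[0,1]$. A continuous map $h:[0,1]\to[0,1]$ is $\lambda$-preserving if $\lambda(A)=\lambda(h^{-1}(A))$ for every Borel set $A\subseteq[0,1]$. A dyadic number is a rational number whose denominator is an integer power of $2$. $\mathbb{G}$ ($\lambda$-preserving Thompson's monoid) is the set of continuous maps $g$ from $[0,1]$ onto $[0,1]$ such that: $g$ is $\lambda$-preserving; $g$ is piecewise affine; $g$ is differentiable except at finitely many points; the $x$-coordinate of each point of non-differentiability is dyadic; and on every interval where $g$ is differentiable, the derivative is of the form $\pm 2^k$ with $k\in\mathbb{Z}$. The maps in the statement are the following maps of $[0,1]$ to itself. $g_{0,+}(x)=x$ and $g_{0,-}(x)=1-x$. $\bar{w}_{3,[\frac14,\frac12]}$: equal to $x$ outside $[\frac14,\frac12]$, and on $[\frac14,\frac12]$ the continuous piecewise affine map with slopes $2,-4,4$ on $[\frac14,\frac38]$, $[\frac38,\frac7{16}]$, $[\frac7{16},\frac12]$ respectively, taking the values $\frac14,\frac12,\frac14,\frac12$ at $\frac14,\frac38,\frac7{16},\frac12$. $w_{2,[\frac34,1]}$: equal to $x$ on $[0,\frac34]$, and on $[\frac34,1]$ continuous and piecewise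 affine with slope $2$ on $[\frac34,\frac78]$ and slope $-2$ on $[\frac78,1]$. $w_{2,[0,1]}(x)=2x$ for $0\le x\le\frac12$ and $2-2x$ for $\frac12\le x\le1$. $f_A(x)=\frac x2$ on $[0,\frac12]$, $x-\frac14$ on $[\frac12,\frac34]$, $2x-1$ on $[\frac34,1]$. $f_B(x)=x$ on $[0,\frac12]$, $\frac x2+\frac14$ on $[\frac12,\frac34]$, $x-\frac18$ on $[\frac34,\frac78]$, $2x-1$ on $[\frac78,1]$. (The intermediate partial compositions are not required to lie in $\mathbb{G}$.) *)

theory Defs
  imports "HOL-Analysis.Analysis"
begin

(* A map of [0,1] to itself is a function of type real => real of which only the values on
   {0..1} are relevant; two such maps are equal iff they agree on {0..1}. *)

definition lebesgue_preserving :: "(real \<Rightarrow> real) \<Rightarrow> bool" where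
  "lebesgue_preserving h \<longleftrightarrow>
     (\<forall>A. A \<in> sets borel \<and> A \<subseteq> {0..1} \<longrightarrow>
        emeasure lborel A = emeasure lborel (h -` A \<inter> {0..1}))"

definition dyadic :: "real \<Rightarrow> bool" where
  "dyadic x \<longleftrightarrow> (\<exists>(m::int) (n::nat). x = of_int m / 2 ^ n)"

(* P is the set of partition points; the pieces are the intervals between neighbours in P. *)
definition piecewise_affine :: "(real \<Rightarrow> real) \<Rightarrow> bool" where
  "piecewise_affine g \<longleftrightarrow>
     (\<exists>P. finite P \<and> {0, 1} \<subseteq> P \<and> P \<subseteq> {0..1} \<and>
        (\<forall>a\<in>P. \<forall>b\<in>P. a < b \<and> {a<..<b} \<inter> P = {} \<longrightarrow>
           (\<exists>m c. \<forall>x\<in>{a..b}. g x = m * x + c)))"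

(* Differentiability relative to {0..1}, that is, one-sided at 0 and at 1. *)
definition nondiff_points :: "(real \<Rightarrow> real) \<Rightarrow> real set" where
  "nondiff_points g = {x \<in> {0..1}. \<not> g differentiable (at x within {0..1})}"

definition thompson_monoid :: "(real \<Rightarrow> real) set" where
  "thompson_monoid =
     {g. continuous_on {0..1} g \<and> g ` {0..1} = {0..1} \<and>
         lebesgue_preserving g \<and>
         piecewise_affine g \<and>
         finite (nondiff_points g) \<and>
         (\<forall>x \<in> nondiff_points g. dyadic x) \<and>
         (\<forall>a b. 0 \<le> a \<and> a < b \<and> b \<le> 1 \<and> g differentiable_on {a<..<b} \<longrightarrow>
            (\<forall>x\<in>{a<..<b}. \<exists>k::int. deriv g x = 2 powi k \<or> deriv g x = - (2 powi k)))}"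

definition g0_plus :: "real \<Rightarrow> real" where
  "g0_plus x = x"

definition g0_minus :: "real \<Rightarrow> real" where
  "g0_minus x = 1 - x"

definition w3_bar :: "real \<Rightarrow> real" where
  "w3_bar x =
     (if x < 1/4 then x
      else if x \<le> 3/8 then 1/4 + 2 * (x - 1/4)
      else if x \<le> 7/16 then 1/2 - 4 * (x - 3/8)
      else if x \<le> 1/2 then 1/4 + 4 * (x - 7/16)
      else x)"

(* The window map that is nontrivial on [3/4,1] only. *)
definition w2_last :: "real \<Rightarrow> real" where
  "w2_last x =
     (if x \<le> 3/4 then x
      else if x \<le> 7/8 then 3/4 + 2 * (x - 3/4)
      else 1 - 2 * (x - 7/8))"

definition w2_full :: "real \<Rightarrow> real" where
  "w2_full x = (if x \<le> 1/2 then 2 * x else 2 - 2 * x)"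

definition f_A :: "real \<Rightarrow> real" where
  "f_A x =
     (if x \<le> 1/2 then x / 2
      else if x \<le> 3/4 then x - 1/4
      else 2 * x - 1)"

definition f_B :: "real \<Rightarrow> real" where
  "f_B x =
     (if x \<le> 1/2 then x
      else if x \<le> 3/4 then x / 2 + 1/4
      else if x \<le> 7/8 then x - 1/8
      else 2 * x - 1)"

lemma bij_betw_f_A: "bij_betw f_A {0..1} {0..1}"
proof (rule bij_betw_byWitness)
  let ?h = "\<lambda>y::real. if y \<le> 1/4 then 2 * y else if y \<le> 1/2 then y + 1/4 else (y + 1) / 2"
  show "\<forall>x\<in>{0..1}. ?h (f_A x) = x" by (auto simp: f_A_def)
  show "\<forall>y\<in>{0..1}. f_A (?h y) = y" by (auto simp: f_A_def field_simps)
  show "f_A ` {0..1} \<subseteq> {0..1}" by (auto simp: f_A_def)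
  show "?h ` {0..1} \<subseteq> {0..1}" by auto
qed

lemma bij_betw_f_B: "bij_betw f_B {0..1} {0..1}"
proof (rule bij_betw_byWitness)
  let ?h = "\<lambda>y::real. if y \<le> 1/2 then y else if y \<le> 5/8 then 2 * y - 1/2
              else if y \<le> 3/4 then y + 1/8 else (y + 1) / 2"
  show "\<forall>x\<in>{0..1}. ?h (f_B x) = x" by (auto simp: f_B_def)
  show "\<forall>y\<in>{0..1}. f_B (?h y) = y" by (auto simp: f_B_def field_simps)
  show "f_B ` {0..1} \<subseteq> {0..1}" by (auto simp: f_B_def)
  show "?h ` {0..1} \<subseteq> {0..1}" by auto
qed

definition generator_maps :: "(real \<Rightarrow> real) set" where
  "generator_maps =
     {g0_plus, g0_minus, w3_bar, w2_last, w2_full,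
      f_A, f_B, inv_into {0..1} f_A, inv_into {0..1} f_B}"

end

theory Submission
  imports Defs
begin

text \<open>
  Concatenating two maps on the two halves of $[0,1]$ is an operation on functions which is
  associative up to precomposition with \<open>f_A\<close>, and congruent modulo precomposition with Thompson's
  group. Modulo this group a map is therefore determined by the list of its affine pieces, where any
  piece may be cut into equal halves; so a map of the monoid, being onto, amounts to a walk on
  $\{0,\dots,2^N\}$ with steps $\pm 1$ that visits both ends, and composition of maps becomes
  composition of walks.

  Among the monotone runs of a walk take one of minimal length $l$. If it lies at an end of the walk,
  or a neighbouring run of the same length does, the walk is a shorter walk composed with a fold at
  that end; otherwise the run and its two neighbours fold back over each other and the walk is a
  shorter walk composed with a zigzag in an interior window. Folds come from \<open>w2_last\<close> and
  \<open>w2_full\<close> (and reflection), interior zigzags from \<open>w3_bar\<close>, and a walk without turns is the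
  identity or the reflection.
\<close>

section \<open>Thompson's group\<close>

text \<open>Explicit inverses of \<open>f_A\<close> and \<open>f_B\<close> on the unit interval;
  \<open>inv_into\<close> does not compute, and its values off the unit interval are
  unspecified.\<close>

definition inv_A :: "real \<Rightarrow> real" where
  "inv_A y = (if y \<le> 1/4 then 2 * y else if y \<le> 1/2 then y + 1/4 else (y + 1) / 2)"

definition inv_B :: "real \<Rightarrow> real" where
  "inv_B y = (if y \<le> 1/2 then y else if y \<le> 5/8 then 2 * y - 1/2
              else if y \<le> 3/4 then y + 1/8 else (y + 1) / 2)"

lemma inv_into_f_A: "y \<in> {0..1} \<Longrightarrow> inv_into {0..1} f_A y = inv_A y"
  by (rule inv_into_f_eq[OF bij_betw_imp_inj_on[OF bij_betw_f_A]])
     (auto simp: f_A_def inv_A_def field_simps)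

lemma inv_into_f_B: "y \<in> {0..1} \<Longrightarrow> inv_into {0..1} f_B y = inv_B y"
  by (rule inv_into_f_eq[OF bij_betw_imp_inj_on[OF bij_betw_f_B]])
     (auto simp: f_B_def inv_B_def add_divide_distrib diff_divide_distrib)

text \<open>Thompson's group given by its two standard generators. \<open>F_cong\<close> forgets the
  values outside \<open>{0..1}\<close>, so membership depends only on the map of the unit
  interval.\<close>

inductive_set thompson_F :: "(real \<Rightarrow> real) set" where
  F_id: "id \<in> thompson_F"
| F_A: "f_A \<in> thompson_F"
| F_B: "f_B \<in> thompson_F"
| F_inv_A: "inv_A \<in> thompson_F"
| F_inv_B: "inv_B \<in> thompson_F"
| F_comp: "f \<in> thompson_F \<Longrightarrow> g \<in> thompson_F \<Longrightarrow> f \<circ> g \<in> thompson_F"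
| F_cong: "f \<in> thompson_F \<Longrightarrow> (\<And>x. x \<in> {0..1} \<Longrightarrow> g x = f x) \<Longrightarrow> g \<in> thompson_F"

lemma F_bounds:
  assumes "f \<in> thompson_F"
  shows "f 0 = 0 \<and> f 1 = 1 \<and> (\<forall>x\<in>{0..1}. f x \<in> {0..1})"
  using assms
  by induction (auto simp: f_A_def f_B_def inv_A_def inv_B_def field_simps)

lemma F_in_unit: "f \<in> thompson_F \<Longrightarrow> x \<in> {0..1} \<Longrightarrow> f x \<in> {0..1}"
  using F_bounds by blast

lemma F_inverse:
  assumes "f \<in> thompson_F"
  shows "\<exists>g\<in>thompson_F. \<forall>x\<in>{0..1}. g (f x) = x \<and> f (g x) = x"
  using assms
proof induction
  case F_id
  show ?case by (rule bexI[of _ id]) (auto intro: thompson_F.F_id)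
next
  case F_A
  show ?case by (rule bexI[of _ inv_A]) (auto simp: f_A_def inv_A_def field_simps intro: thompson_F.F_inv_A)
next
  case F_B
  show ?case by (rule bexI[of _ inv_B]) (auto simp: f_B_def inv_B_def field_simps intro: thompson_F.F_inv_B)
next
  case F_inv_A
  show ?case by (rule bexI[of _ f_A]) (auto simp: f_A_def inv_A_def field_simps intro: thompson_F.F_A)
next
  case F_inv_B
  show ?case by (rule bexI[of _ f_B]) (auto simp: f_B_def inv_B_def field_simps intro: thompson_F.F_B)
next
  case (F_comp f g)
  then obtain f' g' where "f' \<in> thompson_F" "\<forall>x\<in>{0..1}. f' (f x) = x \<and> f (f' x) = x"
    "g' \<in> thompson_F" "\<forall>x\<in>{0..1}. g' (g x) = x \<and> g (g' x) = x" by blast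
  with F_comp.hyps show ?case
    using F_in_unit by (intro bexI[of _ "g' \<circ> f'"]) (auto simp del: atLeastAtMost_iff intro: thompson_F.F_comp)
next
  case (F_cong f g)
  then obtain f' where "f' \<in> thompson_F" "\<forall>x\<in>{0..1}. f' (f x) = x \<and> f (f' x) = x" by blast
  with F_cong.hyps show ?case
    using F_in_unit by (intro bexI[of _ f']) (auto simp del: atLeastAtMost_iff)
qed

text \<open>An inverse sends \<open>f x\<close> back to \<open>x\<close> and 0 to 0. Rescaled to the
  right half this says that points beyond 1/2 stay beyond 1/2, so that definitions by cases at 1/2
  take the expected branch.\<close>

lemma F_pos:
  assumes "f \<in> thompson_F" "0 < x" "x \<le> 1"
  shows "0 < f x"
proof -
  obtain g where "\<forall>x\<in>{0..1}. g (f x) = x \<and> f (g x) = x" using F_inverse assms(1) by blast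
  then have "g (f x) = x" "g (f 0) = 0" using assms by auto
  moreover have "f 0 = 0" "f x \<in> {0..1}" using F_bounds assms by auto
  ultimately have "f x \<noteq> 0" "0 \<le> f x" using assms by auto
  then show ?thesis by simp
qed

text \<open>Left cancellation: a relation in which \<open>g\<close> is the only factor not known to
  lie in the group puts \<open>g\<close> into it as well.\<close>

lemma F_comp_inverse:
  assumes "f \<in> thompson_F" "h \<in> thompson_F" "\<And>x. x \<in> {0..1} \<Longrightarrow> f (g x) = h x" "\<And>x. x \<in> {0..1} \<Longrightarrow> g x \<in> {0..1}"
  shows "g \<in> thompson_F"
proof -
  obtain k where k: "k \<in> thompson_F" "\<forall>x\<in>{0..1}. k (f x) = x \<and> f (k x) = x" using F_inverse assms(1) by blast
  show ?thesis
  proof (rule F_cong[OF F_comp[OF k(1) assms(2)]])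
    fix x :: real assume x: "x \<in> {0..1}"
    have "g x = k (f (g x))" using k(2) assms(4)[OF x] by auto
    thus "g x = (k \<circ> h) x" using assms(3)[OF x] by simp
  qed
qed

section \<open>Copies of a group element on one half of the interval\<close>

definition on_left :: "(real \<Rightarrow> real) \<Rightarrow> real \<Rightarrow> real" where
  "on_left f x = (if x \<le> 1/2 then f (2 * x) / 2 else x)"

definition on_right :: "(real \<Rightarrow> real) \<Rightarrow> real \<Rightarrow> real" where
  "on_right f x = (if x \<le> 1/2 then x else (f (2 * x - 1) + 1) / 2)"

lemma on_left_comp: "g \<in> thompson_F \<Longrightarrow> x \<in> {0..1} \<Longrightarrow> on_left (f \<circ> g) x = on_left f (on_left g x)"
  using F_in_unit[of g "2*x"] by (auto simp: on_left_def)

lemma on_right_comp: "g \<in> thompson_F \<Longrightarrow> x \<in> {0..1} \<Longrightarrow> on_right (f \<circ> g) x = on_right f (on_right g x)"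
  using F_pos[of g "2*x-1"] by (auto simp: on_right_def field_simps)

lemma on_left_unit: "(\<And>x. x \<in> {0..1} \<Longrightarrow> f x \<in> {0..1}) \<Longrightarrow> x \<in> {0..1} \<Longrightarrow> on_left f x \<in> {0..1}"
  by (drule meta_spec[of _ "2 * x"]) (auto simp: on_left_def)

lemma on_right_unit: "(\<And>x. x \<in> {0..1} \<Longrightarrow> f x \<in> {0..1}) \<Longrightarrow> x \<in> {0..1} \<Longrightarrow> on_right f x \<in> {0..1}"
  by (drule meta_spec[of _ "2 * x - 1"]) (auto simp: on_right_def)

lemma f_B_eq: "x \<in> {0..1} \<Longrightarrow> on_right f_A x = f_B x"
  by (auto simp: on_right_def f_A_def f_B_def field_simps)

text \<open>Both sides rebracket \<open>((f g) h) k\<close> to \<open>f (g (h k))\<close> for the operation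
  \<open>join\<close> below, whose associator is \<open>f_A\<close>; solving for \<open>on_left f_A\<close> expresses it in
  terms of \<open>f_A\<close> and \<open>f_B\<close>.\<close>
lemma pentagon:
  assumes "x \<in> {0..1}"
  shows "on_left f_A (f_A (f_B x)) = f_A (f_A x)"
proof -
  consider "x \<le> 1/2" | "1/2 < x" "x \<le> 3/4" | "3/4 < x" "x \<le> 7/8" | "7/8 < x" by linarith
  then show ?thesis
    using assms by cases (auto simp: on_left_def f_A_def f_B_def field_simps)
qed

lemma on_left_A: "on_left f_A \<in> thompson_F"
proof (rule F_cong)
  show "f_A \<circ> (f_A \<circ> (inv_B \<circ> inv_A)) \<in> thompson_F" by (intro F_comp F_A F_B F_inv_A F_inv_B)
  show "on_left f_A x = (f_A \<circ> (f_A \<circ> (inv_B \<circ> inv_A))) x" if "x \<in> {0..1}" for x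
  proof -
    have "inv_A x \<in> {0..1}" "inv_B (inv_A x) \<in> {0..1}"
      using that F_in_unit F_inv_A F_inv_B by blast+
    moreover from this have "f_B (inv_B (inv_A x)) = inv_A x"
      by (auto simp: f_B_def inv_B_def field_simps)
    moreover have "f_A (inv_A x) = x"
      using that by (auto simp: f_A_def inv_A_def field_simps)
    ultimately show ?thesis using pentagon[of "inv_B (inv_A x)"] by simp
  qed
qed

text \<open>\<open>f_A\<close> maps [3/4,1] affinely onto [1/2,1], and \<open>f_B\<close> is the
  copy of \<open>f_A\<close> on [1/2,1]. Conjugating \<open>f_B\<close> by \<open>f_A\<close>
  therefore gives the copy of \<open>f_A\<close> on [3/4,1], which is
  \<open>on_right f_B\<close>.\<close>

lemma on_right_B: "on_right f_B \<in> thompson_F"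
proof -
  have "inv_A \<circ> (f_B \<circ> f_A) \<in> thompson_F" by (intro F_comp F_A F_B F_inv_A F_inv_B)
  moreover have "on_right f_B x = (inv_A \<circ> (f_B \<circ> f_A)) x" if "x \<in> {0..1}" for x
    using that by (auto simp: on_right_def f_A_def inv_A_def f_B_def add_divide_distrib diff_divide_distrib)
  ultimately show ?thesis by (rule F_cong)
qed

text \<open>\<open>inv_A\<close> stretches [0,1/4] affinely onto [0,1/2], so conjugation by it moves
  a copy of \<open>f\<close> from the left half to the first quarter.\<close>

lemma on_left_left:
  assumes "f \<in> thompson_F" "on_left f \<in> thompson_F"
  shows "on_left (on_left f) \<in> thompson_F"
proof (rule F_cong)
  show "f_A \<circ> (on_left f \<circ> inv_A) \<in> thompson_F" by (intro F_comp F_A F_inv_A assms(2))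
  show "on_left (on_left f) x = (f_A \<circ> (on_left f \<circ> inv_A)) x" if "x \<in> {0..1}" for x
    using that F_in_unit[OF assms(1), of "4 * x"]
    by (auto simp: on_left_def f_A_def inv_A_def field_simps)
qed

text \<open>Applying \<open>on_left\<close> to the relation \<open>pentagon\<close> gives a relation
  all of whose factors other than \<open>on_left f_B\<close> are already known to lie in the group;
  cancellation does the rest.\<close>

lemma on_left_B: "on_left f_B \<in> thompson_F"
proof (rule F_comp_inverse)
  show "on_left (on_left f_A) \<circ> on_left f_A \<in> thompson_F"
    by (intro F_comp on_left_A on_left_left F_A)
  show "on_left f_A \<circ> on_left f_A \<in> thompson_F" by (intro F_comp on_left_A)
  show "x \<in> {0..1} \<Longrightarrow> on_left f_B x \<in> {0..1}" for x
    by (rule on_left_unit[OF F_in_unit[OF F_B]])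
  fix x :: real assume x: "x \<in> {0..1}"
  have "(on_left (on_left f_A) \<circ> on_left f_A) (on_left f_B x) = on_left (on_left f_A \<circ> (f_A \<circ> f_B)) x"
    using x by (simp add: on_left_comp F_A F_B F_comp del: atLeastAtMost_iff)
  also have "\<dots> = on_left (f_A \<circ> f_A) x"
    using x pentagon[of "2 * x"] by (simp add: on_left_def)
  also have "\<dots> = (on_left f_A \<circ> on_left f_A) x"
    using x by (simp add: on_left_comp F_A)
  finally show "(on_left (on_left f_A) \<circ> on_left f_A) (on_left f_B x) = (on_left f_A \<circ> on_left f_A) x" .
qed

lemma on_left_F:
  assumes "f \<in> thompson_F"
  shows "on_left f \<in> thompson_F"
  using assms
proof induction
  case F_id
  show ?case by (rule F_cong[OF thompson_F.F_id]) (auto simp: on_left_def)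
next
  case F_inv_A
  show ?case
    by (rule F_comp_inverse[OF on_left_A thompson_F.F_id])
       (auto intro!: on_left_unit simp: on_left_def f_A_def inv_A_def algebra_simps add_divide_distrib diff_divide_distrib)
next
  case F_inv_B
  show ?case
    by (rule F_comp_inverse[OF on_left_B thompson_F.F_id])
       (auto intro!: on_left_unit simp: on_left_def f_B_def inv_B_def algebra_simps add_divide_distrib diff_divide_distrib)
next
  case (F_comp f g)
  then show ?case
    by (intro F_cong[OF thompson_F.F_comp[OF F_comp.IH]]) (simp only: on_left_comp o_apply[of "on_left f"])
next
  case (F_cong f g)
  then show ?case
    by (intro thompson_F.F_cong[OF F_cong.IH]) (auto simp: on_left_def)
qed (fact on_left_A on_left_B)+

lemma on_right_F:
  assumes "f \<in> thompson_F"
  shows "on_right f \<in> thompson_F"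
  using assms
proof induction
  case F_id
  show ?case by (rule F_cong[OF thompson_F.F_id]) (auto simp: on_right_def)
next
  case F_A
  show ?case by (rule F_cong[OF thompson_F.F_B f_B_eq])
next
  case F_B
  show ?case by (fact on_right_B)
next
  case F_inv_A
  show ?case
    by (rule thompson_F.F_cong[OF thompson_F.F_inv_B]) (auto simp: on_right_def inv_A_def inv_B_def field_simps)
next
  case F_inv_B
  show ?case
    by (rule F_comp_inverse[OF on_right_B thompson_F.F_id])
       (auto intro!: on_right_unit simp: on_right_def f_B_def inv_B_def algebra_simps add_divide_distrib diff_divide_distrib)
next
  case (F_comp f g)
  then show ?case
    by (intro F_cong[OF thompson_F.F_comp[OF F_comp.IH]]) (simp only: on_right_comp o_apply[of "on_right f"])
next
  case (F_cong f g)
  then show ?case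
    by (intro thompson_F.F_cong[OF F_cong.IH]) (auto simp: on_right_def)
qed

section \<open>Concatenation of maps up to right multiplication by Thompson's group\<close>

definition join :: "(real \<Rightarrow> real) \<Rightarrow> (real \<Rightarrow> real) \<Rightarrow> real \<Rightarrow> real" where
  "join f g x = (if x \<le> 1/2 then f (2 * x) else g (2 * x - 1))"

text \<open>Equality up to a reparametrisation of the source by Thompson's group. The generators of
  the group are among the allowed factors, so being a product of generators depends only on the
  class.\<close>

definition fequiv :: "(real \<Rightarrow> real) \<Rightarrow> (real \<Rightarrow> real) \<Rightarrow> bool"  (infix "\<doteq>" 50) where
  "f \<doteq> g \<longleftrightarrow> (\<exists>h\<in>thompson_F. \<forall>x\<in>{0..1}. f x = g (h x))"

lemma fequivI: "h \<in> thompson_F \<Longrightarrow> (\<And>x. x \<in> {0..1} \<Longrightarrow> f x = g (h x)) \<Longrightarrow> f \<doteq> g"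
  unfolding fequiv_def by blast

lemma fequiv_eqI: "(\<And>x. x \<in> {0..1} \<Longrightarrow> f x = g x) \<Longrightarrow> f \<doteq> g"
  by (rule fequivI[OF F_id]) simp

lemma fequiv_refl: "f \<doteq> f"
  by (rule fequiv_eqI) simp

lemma fequiv_trans [trans]:
  assumes "f \<doteq> g" "g \<doteq> k"
  shows "f \<doteq> k"
proof -
  obtain h h' where h: "h \<in> thompson_F" "\<forall>x\<in>{0..1}. f x = g (h x)" "h' \<in> thompson_F" "\<forall>x\<in>{0..1}. g x = k (h' x)"
    using assms unfolding fequiv_def by blast
  show ?thesis
    by (rule fequivI[of "h' \<circ> h"]) (use h F_in_unit in \<open>auto simp del: atLeastAtMost_iff intro: F_comp\<close>)
qed

lemma fequiv_sym:
  assumes "f \<doteq> g"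
  shows "g \<doteq> f"
proof -
  obtain h where h: "h \<in> thompson_F" "\<forall>x\<in>{0..1}. f x = g (h x)"
    using assms unfolding fequiv_def by blast
  obtain k where k: "k \<in> thompson_F" "\<forall>x\<in>{0..1}. k (h x) = x \<and> h (k x) = x"
    using F_inverse h(1) by blast
  show ?thesis
    by (rule fequivI[of k]) (use h k F_in_unit in \<open>auto simp del: atLeastAtMost_iff\<close>)
qed

lemma fequiv_F: "f \<doteq> g \<Longrightarrow> g \<in> thompson_F \<Longrightarrow> f \<in> thompson_F"
  unfolding fequiv_def by (metis F_comp F_cong comp_apply)

text \<open>The two reparametrisations act independently on the two halves. This is where closure of
  the group under \<open>on_left\<close> and \<open>on_right\<close> enters.\<close>

lemma join_fequiv:
  assumes "f \<doteq> f'" "g \<doteq> g'"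
  shows "join f g \<doteq> join f' g'"
proof -
  obtain h k where h: "h \<in> thompson_F" "\<forall>x\<in>{0..1}. f x = f' (h x)" and k: "k \<in> thompson_F" "\<forall>x\<in>{0..1}. g x = g' (k x)"
    using assms unfolding fequiv_def by blast
  show ?thesis
  proof (rule fequivI[of "on_left h \<circ> on_right k"])
    show "on_left h \<circ> on_right k \<in> thompson_F" by (intro F_comp on_left_F on_right_F h k)
    show "join f g x = join f' g' ((on_left h \<circ> on_right k) x)" if "x \<in> {0..1}" for x
      using that h(2) k(2) F_in_unit[OF h(1), of "2*x"] F_pos[OF k(1), of "2*x-1"]
      by (auto simp: join_def on_left_def on_right_def algebra_simps add_divide_distrib diff_divide_distrib)
  qed
qed

text \<open>\<open>f_A\<close> carries the intervals cut out by 0, 1/2, 3/4, 1 affinely onto those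
  cut out by 0, 1/4, 1/2, 1, which are the supports of the three pieces in the two
  bracketings.\<close>

lemma join_assoc: "join f (join g h) \<doteq> join (join f g) h"
  by (rule fequivI[OF F_A]) (auto simp: join_def f_A_def algebra_simps add_divide_distrib diff_divide_distrib)

section \<open>Piecewise affine maps given by their increments\<close>

lemma fequiv_eq_trans [trans]: "f \<doteq> g \<Longrightarrow> g = h \<Longrightarrow> f \<doteq> h"
  by simp

lemma eq_fequiv_trans [trans]: "f = g \<Longrightarrow> g \<doteq> h \<Longrightarrow> f \<doteq> h"
  by simp

text \<open>The map starting at \<open>a\<close> whose affine pieces have the successive increments
  \<open>ds\<close>. The bracketing to the right is a normal form: each piece but the last takes
  half of the remaining interval. The constant map for the empty list is a default.\<close>

fun broken_line :: "real \<Rightarrow> real list \<Rightarrow> real \<Rightarrow> real" where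
  "broken_line a [] = (\<lambda>x. a)"
| "broken_line a (d # ds) = (if ds = [] then (\<lambda>x. a + d * x) else join (\<lambda>x. a + d * x) (broken_line (a + d) ds))"

lemma broken_line_0 [simp]: "broken_line a ds 0 = a"
  by (induction ds arbitrary: a) (auto simp: join_def)

lemma broken_line_1: "ds \<noteq> [] \<Longrightarrow> broken_line a ds 1 = a + sum_list ds"
  by (induction ds arbitrary: a) (auto simp: join_def)

text \<open>Associativity up to the group allows a list to be cut anywhere, not only behind its
  head.\<close>

lemma broken_line_append:
  assumes "xs \<noteq> []" "ys \<noteq> []"
  shows "broken_line a (xs @ ys) \<doteq> join (broken_line a xs) (broken_line (a + sum_list xs) ys)"
  using assms(1)
proof (induction xs arbitrary: a)
  case (Cons d xs)
  show ?case
  proof (cases "xs = []")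
    case True
    then show ?thesis using assms(2) by (simp add: fequiv_refl)
  next
    case False
    let ?s = "\<lambda>x. a + d * x"
    have "broken_line a ((d # xs) @ ys) = join ?s (broken_line (a + d) (xs @ ys))"
      using False by simp
    also have "\<dots> \<doteq> join ?s (join (broken_line (a + d) xs) (broken_line (a + d + sum_list xs) ys))"
      by (intro join_fequiv fequiv_refl Cons.IH False)
    also have "\<dots> \<doteq> join (join ?s (broken_line (a + d) xs)) (broken_line (a + d + sum_list xs) ys)"
      by (rule join_assoc)
    also have "\<dots> = join (broken_line a (d # xs)) (broken_line (a + sum_list (d # xs)) ys)"
      using False by (simp add: add.assoc)
    finally show ?thesis .
  qed
qed simp

lemma broken_line_append_cong:
  assumes "broken_line a xs \<doteq> broken_line a xs'" "sum_list xs' = sum_list xs"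
    "broken_line (a + sum_list xs) ys \<doteq> broken_line (a + sum_list xs) ys'"
    "xs \<noteq> []" "ys \<noteq> []" "xs' \<noteq> []" "ys' \<noteq> []"
  shows "broken_line a (xs @ ys) \<doteq> broken_line a (xs' @ ys')"
proof -
  have "broken_line a (xs @ ys) \<doteq> join (broken_line a xs) (broken_line (a + sum_list xs) ys)"
    by (intro broken_line_append assms)
  also have "\<dots> \<doteq> join (broken_line a xs') (broken_line (a + sum_list xs) ys')"
    by (intro join_fequiv assms)
  also have "\<dots> \<doteq> broken_line a (xs' @ ys')"
    using fequiv_sym[OF broken_line_append[of xs' ys' a]] assms by simp
  finally show ?thesis .
qed

lemma sum_list_uminus: "sum_list (map uminus ds) = - sum_list (ds :: real list)"
  by (induction ds) auto

text \<open>The hypothesis serves the midpoint: there each \<open>join\<close> takes its left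
  branch, and the left branches of the two sides are different maps.\<close>

lemma join_reverse:
  assumes "f 1 = g 0"
  shows "join f g (1 - x) = join (\<lambda>x. g (1 - x)) (\<lambda>x. f (1 - x)) x"
  using assms by (cases "x = 1/2") (auto simp: join_def algebra_simps)

lemma broken_line_reverse:
  assumes "ds \<noteq> []"
  shows "(\<lambda>x. broken_line a ds (1 - x)) \<doteq> broken_line (a + sum_list ds) (rev (map uminus ds))"
  using assms
proof (induction ds arbitrary: a)
  case (Cons d ds)
  show ?case
  proof (cases "ds = []")
    case True
    then show ?thesis by (intro fequiv_eqI) (auto simp: algebra_simps)
  next
    case False
    let ?s = "\<lambda>x. a + d * x" and ?b = "a + d + sum_list ds"
    have "(\<lambda>x. broken_line a (d # ds) (1 - x)) = join (\<lambda>x. broken_line (a + d) ds (1 - x)) (\<lambda>x. ?s (1 - x))"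
      using False by (auto simp: join_reverse)
    also have "\<dots> \<doteq> join (broken_line ?b (rev (map uminus ds))) (broken_line (?b + sum_list (rev (map uminus ds))) [- d])"
      by (intro join_fequiv Cons.IH False fequiv_eqI)
         (auto simp: algebra_simps sum_list_uminus)
    also have "\<dots> \<doteq> broken_line ?b (rev (map uminus ds) @ [- d])"
      by (rule fequiv_sym[OF broken_line_append]) (use False in auto)
    finally show ?thesis by (simp add: add.assoc)
  qed
qed simp

section \<open>Common refinement of increments by halving\<close>

lemma broken_line_halve: "broken_line a [d] = broken_line a [d / 2, d / 2]"
  by (auto simp: join_def field_simps)

lemma broken_line_replicate: "broken_line a [d] \<doteq> broken_line a (replicate (2 ^ k) (d / 2 ^ k))"
proof (induction k arbitrary: a d)
  case (Suc k)
  let ?r = "replicate (2 ^ k) (d / 2 / 2 ^ k)"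
  have "broken_line a [d] = broken_line a ([d / 2] @ [d / 2])"
    by (simp only: broken_line_halve[of a d] append.simps)
  also have "\<dots> \<doteq> broken_line a (?r @ ?r)"
    by (intro broken_line_append_cong Suc.IH) (auto simp: sum_list_replicate)
  also have "?r @ ?r = replicate (2 ^ Suc k) (d / 2 ^ Suc k)"
    by (simp only: replicate_add[symmetric] power_Suc mult_2 divide_divide_eq_left)
  finally show ?case .
qed (simp add: fequiv_refl)

text \<open>An increment of size \<open>2 ^ k * e\<close> is halved \<open>k\<close> times. Halving
  keeps signs, which the last clause records for the increasing case.\<close>

lemma broken_line_refine:
  assumes "ds \<noteq> []" "\<forall>d\<in>set ds. \<exists>k::nat. \<bar>d\<bar> = 2 ^ k * e" "0 < e"
  shows "\<exists>es. es \<noteq> [] \<and> broken_line a ds \<doteq> broken_line a es \<and> sum_list es = sum_list ds \<and>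
    (\<forall>x\<in>set es. \<bar>x\<bar> = e) \<and> ((\<forall>d\<in>set ds. 0 < d) \<longrightarrow> (\<forall>x\<in>set es. 0 < x))"
  using assms(1,2)
proof (induction ds arbitrary: a)
  case (Cons d ds)
  obtain k :: nat where k: "\<bar>d\<bar> = 2 ^ k * e" using Cons.prems by auto
  let ?r = "replicate (2 ^ k) (d / 2 ^ k)"
  have r: "?r \<noteq> []" "broken_line a [d] \<doteq> broken_line a ?r" "sum_list ?r = d" "\<forall>x\<in>set ?r. \<bar>x\<bar> = e"
    "0 < d \<longrightarrow> (\<forall>x\<in>set ?r. 0 < x)"
    using k broken_line_replicate[of a d k] by (auto simp: sum_list_replicate)
  show ?case
  proof (cases "ds = []")
    case True
    then show ?thesis using r by (intro exI[of _ ?r]) auto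
  next
    case False
    then obtain es where es: "es \<noteq> []" "broken_line (a + d) ds \<doteq> broken_line (a + d) es" "sum_list es = sum_list ds"
      "\<forall>x\<in>set es. \<bar>x\<bar> = e" "(\<forall>d\<in>set ds. 0 < d) \<longrightarrow> (\<forall>x\<in>set es. 0 < x)"
      using Cons.IH[of "a + d"] Cons.prems by auto
    have "broken_line a ([d] @ ds) \<doteq> broken_line a (?r @ es)"
      using r es False by (intro broken_line_append_cong) auto
    then show ?thesis using r es by (intro exI[of _ "?r @ es"]) auto
  qed
qed simp

text \<open>The absolute value is an integral power of 2; two natural exponents stand for one
  integer exponent.\<close>

definition dyadic_step :: "real \<Rightarrow> bool" where
  "dyadic_step d \<longleftrightarrow> (\<exists>k N :: nat. \<bar>d\<bar> = 2 ^ k / 2 ^ N)"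

lemma dyadic_step_common:
  assumes "\<forall>d\<in>set ds. dyadic_step d"
  shows "\<exists>N::nat. \<forall>d\<in>set ds. \<exists>k::nat. \<bar>d\<bar> = 2 ^ k * (1 / 2 ^ N)"
  using assms
proof (induction ds)
  case (Cons d ds)
  then obtain N :: nat where N: "\<forall>d\<in>set ds. \<exists>k::nat. \<bar>d\<bar> = 2 ^ k * (1 / 2 ^ N)" by auto
  obtain k M :: nat where M: "\<bar>d\<bar> = 2 ^ k / 2 ^ M" using Cons.prems by (auto simp: dyadic_step_def)
  have "\<exists>k::nat. \<bar>x\<bar> = 2 ^ k * (1 / 2 ^ (N + M))" if x: "x \<in> set (d # ds)" for x
  proof (cases "x = d")
    case True
    then show ?thesis using M by (intro exI[of _ "k + N"]) (simp add: power_add)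
  next
    case False
    then obtain j :: nat where "\<bar>x\<bar> = 2 ^ j * (1 / 2 ^ N)" using x N by auto
    then show ?thesis by (intro exI[of _ "j + M"]) (simp add: power_add)
  qed
  then show ?case by blast
qed simp

text \<open>Cut all pieces down to a common size \<open>1 / 2 ^ N\<close>. As they are positive with
  sum 1, there are exactly \<open>2 ^ N\<close> equal ones, and undoing the halvings of a single
  piece of length 1 leads to the identity.\<close>

lemma broken_line_in_F:
  assumes "ds \<noteq> []" "\<forall>d\<in>set ds. dyadic_step d \<and> 0 < d" "sum_list ds = 1"
  shows "broken_line 0 ds \<in> thompson_F"
proof -
  obtain N :: nat where "\<forall>d\<in>set ds. \<exists>k::nat. \<bar>d\<bar> = 2 ^ k * (1 / 2 ^ N)"
    using dyadic_step_common assms(2) by blast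
  then obtain es where es: "broken_line 0 ds \<doteq> broken_line 0 es" "sum_list es = 1" "\<forall>x\<in>set es. \<bar>x\<bar> = 1 / 2 ^ N"
    "\<forall>x\<in>set es. 0 < x"
    using broken_line_refine[of ds "1 / 2 ^ N" 0] assms by auto
  have "es = replicate (length es) (1 / 2 ^ N)"
    using es(3,4) by (intro replicate_eqI) (auto, fastforce)
  moreover from this have "length es = 2 ^ N"
  proof -
    have "real (length es) * (1 / 2 ^ N) = 1"
      using es(2) arg_cong[OF \<open>es = replicate (length es) (1 / 2 ^ N)\<close>, of sum_list]
      by (simp add: sum_list_replicate)
    then have "real (length es) = real (2 ^ N)" by (simp add: field_simps)
    then show ?thesis by (simp only: of_nat_eq_iff)
  qed
  ultimately have "broken_line 0 es \<doteq> broken_line 0 [1]"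
    using fequiv_sym[OF broken_line_replicate[of 0 1 N]] by simp
  with es(1) have "broken_line 0 ds \<doteq> broken_line 0 [1]" by (rule fequiv_trans)
  moreover have "broken_line 0 [1] \<in> thompson_F" by (rule F_cong[OF F_id]) simp
  ultimately show ?thesis by (rule fequiv_F)
qed

section \<open>Piecewise affine maps given by their successive values\<close>

definition polyline :: "(nat \<Rightarrow> real) \<Rightarrow> nat \<Rightarrow> real \<Rightarrow> real" where
  "polyline v n = broken_line (v 0) (map (\<lambda>i. v (Suc i) - v i) [0..<n])"

lemma polyline_1: "polyline v (Suc 0) x = v 0 + (v (Suc 0) - v 0) * x"
  by (simp add: polyline_def)

lemma polyline_Suc:
  assumes "0 < n"
  shows "polyline v (Suc n) = join (\<lambda>x. v 0 + (v (Suc 0) - v 0) * x) (polyline (\<lambda>i. v (Suc i)) n)"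
proof -
  have "map (\<lambda>i. v (Suc i) - v i) [0..<Suc n] = (v (Suc 0) - v 0) # map (\<lambda>i. v (Suc (Suc i)) - v (Suc i)) [0..<n]"
    by (subst upt_conv_Cons) (auto simp: map_Suc_upt[symmetric] simp del: upt_Suc)
  then show ?thesis using assms by (simp add: polyline_def del: upt_Suc)
qed

lemma polyline_0 [simp]: "polyline v n 0 = v 0"
  by (simp add: polyline_def)

lemma polyline_cong: "(\<And>i. i \<le> n \<Longrightarrow> v i = w i) \<Longrightarrow> polyline v n = polyline w n"
  unfolding polyline_def by (auto intro!: arg_cong2[where f = broken_line])

text \<open>Postcomposition acts on the list of values alone as long as \<open>g\<close> is affine
  on every segment that is traversed.\<close>

lemma comp_polyline:
  assumes "0 < n" "x \<in> {0..1}"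
    "\<And>i t. i < n \<Longrightarrow> t \<in> {0..1} \<Longrightarrow>
       g (v i + (v (Suc i) - v i) * t) = g (v i) + (g (v (Suc i)) - g (v i)) * t"
  shows "g (polyline v n x) = polyline (\<lambda>i. g (v i)) n x"
  using assms
proof (induction n arbitrary: v x)
  case (Suc n)
  show ?case
  proof (cases "n = 0")
    case True
    then show ?thesis using Suc.prems by (simp add: polyline_1)
  next
    case False
    have "g (polyline (\<lambda>i. v (Suc i)) n y) = polyline (\<lambda>i. g (v (Suc i))) n y" if "y \<in> {0..1}" for y
      using Suc.IH[of y "\<lambda>i. v (Suc i)"] Suc.prems False that by auto
    then show ?thesis
      using False Suc.prems(2) Suc.prems(3)[of 0 "2 * x"] by (auto simp: polyline_Suc join_def)
  qed
qed simp

lemma polyline_value: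
  assumes "0 < n" "x \<in> {0..1}"
  shows "\<exists>i<n. \<exists>t\<in>{0..1}. polyline v n x = v i + (v (Suc i) - v i) * t"
  using assms
proof (induction n arbitrary: v x)
  case (Suc n)
  consider "n = 0" | "0 < n" "x \<le> 1/2" | "0 < n" "1/2 < x" by linarith
  then show ?case
  proof cases
    case 1
    then show ?thesis using Suc.prems by (auto simp: polyline_1)
  next
    case 2
    then show ?thesis using Suc.prems
      by (intro exI[of _ 0] conjI bexI[of _ "2 * x"]) (auto simp: polyline_Suc join_def)
  next
    case 3
    then have "\<exists>i<n. \<exists>t\<in>{0..1}. polyline (\<lambda>i. v (Suc i)) n (2 * x - 1) = v (Suc i) + (v (Suc (Suc i)) - v (Suc i)) * t"
      using Suc.prems by (intro Suc.IH) auto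
    then show ?thesis using 3 by (fastforce simp: polyline_Suc join_def)
  qed
qed simp

text \<open>The breakpoints of \<open>polyline v m\<close>: the right-nested bracketing halves the last interval each time.\<close>
definition node :: "nat \<Rightarrow> nat \<Rightarrow> real" where
  "node m i = (if i < m then 1 - 1 / 2 ^ i else 1)"

lemma node_Suc: "0 < m \<Longrightarrow> node (Suc m) (Suc i) = (1 + node m i) / 2"
  by (auto simp: node_def field_simps)

lemma node_unit: "node m i \<in> {0..1}"
  by (auto simp: node_def field_simps)

lemma polyline_node_affine:
  assumes "i < m" "t \<in> {0..1}"
  shows "polyline v m (node m i + (node m (Suc i) - node m i) * t) = v i + (v (Suc i) - v i) * t"
  using assms
proof (induction m arbitrary: v i)
  case (Suc m)
  show ?case
  proof (cases "m = 0")
    case True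
    then show ?thesis using Suc.prems by (simp add: polyline_1 node_def)
  next
    case False
    show ?thesis
    proof (cases i)
      case 0
      then show ?thesis using False Suc.prems by (simp add: polyline_Suc join_def node_def)
    next
      case (Suc j)
      let ?y = "node m j + (node m (Suc j) - node m j) * t"
      have y: "node (Suc m) i + (node (Suc m) (Suc i) - node (Suc m) i) * t = (1 + ?y) / 2"
        using False Suc by (simp add: node_Suc field_simps)
      have "0 \<le> ?y"
      proof -
        have "?y = (1 - t) * node m j + t * node m (Suc j)" by (simp add: algebra_simps)
        then show ?thesis using node_unit[of m] Suc.prems by auto
      qed
      moreover have "polyline (\<lambda>i. v (Suc i)) m ?y = v i + (v (Suc i) - v i) * t"
        using Suc.IH[of j "\<lambda>i. v (Suc i)"] Suc.prems Suc by simp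
      \<comment> \<open>If \<open>?y = 0\<close> the argument is the midpoint, which
        \<open>join\<close> assigns to its left branch; both branches have the value
        \<open>v 1\<close> there.\<close>
      ultimately show ?thesis
        unfolding y using False Suc
        by (cases "?y = 0") (auto simp: polyline_Suc join_def add_divide_distrib)
    qed
  qed
qed simp

lemma polyline_node:
  assumes "0 < m" "i \<le> m"
  shows "polyline v m (node m i) = v i"
proof (cases "i = m")
  case True
  then show ?thesis using polyline_node_affine[of "m - 1" m 1 v] assms by simp
next
  case False
  then show ?thesis using polyline_node_affine[of i m 0 v] assms by simp
qed

section \<open>Composition of polylines as composition of walks\<close>

definition walk :: "(nat \<Rightarrow> nat) \<Rightarrow> nat \<Rightarrow> bool" where
  "walk u n \<longleftrightarrow> (\<forall>i<n. u (Suc i) = Suc (u i) \<or> u i = Suc (u (Suc i)))"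

text \<open>Each step of \<open>u\<close> crosses one interval between neighbouring nodes, forwards
  or backwards, and \<open>polyline v m\<close> is affine on that interval. Hence only the index
  maps are composed.\<close>

lemma polyline_comp_walk:
  assumes "0 < m" "0 < n" "walk u n" "\<And>i. i \<le> n \<Longrightarrow> u i \<le> m" "x \<in> {0..1}"
  shows "polyline v m (polyline (\<lambda>i. node m (u i)) n x) = polyline (\<lambda>i. v (u i)) n x"
proof -
  have "polyline v m (polyline (\<lambda>i. node m (u i)) n x) = polyline (\<lambda>i. polyline v m (node m (u i))) n x"
  proof (rule comp_polyline)
    fix i and t :: real assume i: "i < n" and t: "t \<in> {0..1}"
    have le: "u i \<le> m" "u (Suc i) \<le> m" using assms(4) i by auto
    consider "u (Suc i) = Suc (u i)" | "u i = Suc (u (Suc i))" using assms(3) i by (auto simp: walk_def)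
    then show "polyline v m (node m (u i) + (node m (u (Suc i)) - node m (u i)) * t) =
      polyline v m (node m (u i)) + (polyline v m (node m (u (Suc i))) - polyline v m (node m (u i))) * t"
    proof cases
      case 1
      then show ?thesis using polyline_node_affine[of "u i" m t v] le t assms(1) by (simp add: polyline_node)
    next
      case 2
      have "node m (u i) + (node m (u (Suc i)) - node m (u i)) * t =
        node m (u (Suc i)) + (node m (u i) - node m (u (Suc i))) * (1 - t)" by (simp add: algebra_simps)
      then show ?thesis using polyline_node_affine[of "u (Suc i)" m "1 - t" v] 2 le t assms(1)
        by (simp add: polyline_node algebra_simps)
    qed
  qed (use assms in auto)
  also have "\<dots> = polyline (\<lambda>i. v (u i)) n x"
    using assms(1,4) by (intro fun_cong[OF polyline_cong]) (simp add: polyline_node)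
  finally show ?thesis .
qed

section \<open>Folds and zigzags as products of generators\<close>

definition generated :: "(real \<Rightarrow> real) set" where
  "generated = {f. \<exists>fs. set fs \<subseteq> generator_maps \<and> (\<forall>x\<in>{0..1}. f x = foldr (\<circ>) fs id x)}"

lemma generator_in_unit:
  assumes "s \<in> generator_maps" "x \<in> {0..1}"
  shows "s x \<in> {0..1}"
proof -
  consider "s \<in> {g0_plus, g0_minus, w3_bar, w2_last, w2_full}"
    | "s = f_A" | "s = f_B" | "s x = inv_A x" | "s x = inv_B x"
    using assms inv_into_f_A inv_into_f_B by (auto simp: generator_maps_def)
  then show ?thesis
  proof cases
    case 1
    then show ?thesis using assms(2)
      by (auto simp: g0_plus_def g0_minus_def w3_bar_def w2_last_def w2_full_def)
  qed (use assms(2) F_in_unit F_A F_B F_inv_A F_inv_B in \<open>metis+\<close>)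
qed

lemma foldr_in_unit:
  "set fs \<subseteq> generator_maps \<Longrightarrow> x \<in> {0..1} \<Longrightarrow> foldr (\<circ>) fs id x \<in> {0..1}"
  by (induction fs) (auto simp del: atLeastAtMost_iff intro: generator_in_unit)

lemma foldr_comp_append: "foldr (\<circ>) (fs @ gs) id x = foldr (\<circ>) fs id (foldr (\<circ>) gs id x)"
  by (induction fs) auto

lemma generated_generator: "s \<in> generator_maps \<Longrightarrow> s \<in> generated"
  unfolding generated_def by (intro CollectI exI[of _ "[s]"]) auto

lemma generated_cong: "f \<in> generated \<Longrightarrow> (\<And>x. x \<in> {0..1} \<Longrightarrow> g x = f x) \<Longrightarrow> g \<in> generated"
  unfolding generated_def by auto

lemma generated_comp:
  assumes "f \<in> generated" "g \<in> generated"
  shows "f \<circ> g \<in> generated"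
proof -
  obtain fs gs where fs: "set fs \<subseteq> generator_maps" "\<forall>x\<in>{0..1}. f x = foldr (\<circ>) fs id x"
    and gs: "set gs \<subseteq> generator_maps" "\<forall>x\<in>{0..1}. g x = foldr (\<circ>) gs id x"
    using assms unfolding generated_def by blast
  have "(f \<circ> g) x = foldr (\<circ>) (fs @ gs) id x" if x: "x \<in> {0..1}" for x
    using fs gs x foldr_in_unit[OF gs(1) x] by (simp only: foldr_comp_append o_apply)
  then show ?thesis unfolding generated_def using fs(1) gs(1) by (intro CollectI exI[of _ "fs @ gs"]) auto
qed

lemma F_subset_generated: "f \<in> thompson_F \<Longrightarrow> f \<in> generated"
proof (induction rule: thompson_F.induct)
  case F_id
  show ?case by (rule generated_cong[of g0_plus]) (auto intro: generated_generator simp: generator_maps_def g0_plus_def)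
next
  case F_inv_A
  show ?case by (rule generated_cong[of "inv_into {0..1} f_A"])
    (auto intro: generated_generator simp: generator_maps_def inv_into_f_A)
next
  case F_inv_B
  show ?case by (rule generated_cong[of "inv_into {0..1} f_B"])
    (auto intro: generated_generator simp: generator_maps_def inv_into_f_B)
next
  case (F_cong f g)
  then show ?case using generated_cong by blast
qed (auto intro: generated_generator generated_comp simp: generator_maps_def simp del: o_apply)

lemma generated_fequiv:
  assumes "f \<doteq> g" "g \<in> generated"
  shows "f \<in> generated"
proof -
  obtain h where h: "h \<in> thompson_F" "\<forall>x\<in>{0..1}. f x = g (h x)" using assms(1) unfolding fequiv_def by blast
  show ?thesis by (rule generated_cong[OF generated_comp[OF assms(2) F_subset_generated[OF h(1)]]]) (use h(2) in auto)
qed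

lemma join_broken_line:
  assumes "f \<doteq> broken_line a xs" "g \<doteq> broken_line b ys" "b = a + sum_list xs" "xs \<noteq> []" "ys \<noteq> []"
  shows "join f g \<doteq> broken_line a (xs @ ys)"
proof -
  have "join f g \<doteq> join (broken_line a xs) (broken_line b ys)" by (intro join_fequiv assms)
  also have "\<dots> \<doteq> broken_line a (xs @ ys)" unfolding assms(3) by (intro fequiv_sym[OF broken_line_append] assms)
  finally show ?thesis .
qed

text \<open>A tent map in front of an increasing map makes it run through \<open>B\<close> and then
  back. If \<open>A\<close> is empty the tent covers the whole interval, otherwise the right half,
  where \<open>join\<close> places \<open>B\<close>.\<close>

lemma fold_in_generated:
  assumes "B \<noteq> []" "\<forall>d\<in>set (A @ B). dyadic_step d \<and> 0 < d" "sum_list (A @ B) = 1"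
  shows "broken_line 0 (A @ B @ rev (map uminus B)) \<in> generated"
proof (cases "A = []")
  case True
  let ?b = "broken_line 0 B"
  have w: "w2_full \<in> generated" by (rule generated_generator) (simp add: generator_maps_def)
  have "?b \<in> thompson_F" using assms True by (intro broken_line_in_F) auto
  then have "?b \<circ> w2_full \<in> generated" by (rule generated_comp[OF F_subset_generated w])
  moreover have "?b \<circ> w2_full = join ?b (\<lambda>x. ?b (1 - x))"
    by (auto simp: w2_full_def join_def algebra_simps)
  moreover have "join ?b (\<lambda>x. ?b (1 - x)) \<doteq> broken_line 0 (B @ rev (map uminus B))"
    by (intro join_broken_line[OF fequiv_refl broken_line_reverse]) (use assms in auto)
  ultimately show ?thesis using True generated_fequiv[OF fequiv_sym] by simp
next
  case False
  let ?a = "broken_line 0 A" and ?b = "broken_line (sum_list A) B"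
  txt \<open>Conjugation by \<open>f_A\<close> moves the fold of \<open>w2_last\<close> from $[3/4,1]$ to $[1/2,1]$.\<close>
  define T where "T = f_A \<circ> (w2_last \<circ> inv_A)"
  have "T \<in> generated" unfolding T_def
    by (intro generated_comp F_subset_generated F_A F_inv_A generated_generator) (simp add: generator_maps_def)
  have T_left: "T x = x" if "x \<le> 1/2" for x
    using that by (auto simp: T_def f_A_def w2_last_def inv_A_def)
  have T_right: "T x = (w2_full (2 * x - 1) + 1) / 2" if "1/2 < x" "x \<le> 1" for x
    using that by (auto simp: T_def f_A_def w2_last_def inv_A_def w2_full_def field_simps)
  have "join ?a ?b \<doteq> broken_line 0 (A @ B)"
    by (intro join_broken_line fequiv_refl) (use assms False in \<open>auto intro: fequiv_refl\<close>)
  moreover have "broken_line 0 (A @ B) \<in> thompson_F" using assms False by (intro broken_line_in_F) auto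
  ultimately have "join ?a ?b \<circ> T \<in> generated"
    by (intro generated_comp F_subset_generated[OF fequiv_F] \<open>T \<in> generated\<close>)
  moreover have "join ?a (join ?b (\<lambda>x. ?b (1 - x))) x = (join ?a ?b \<circ> T) x" if x: "x \<in> {0..1}" for x
  proof -
    consider "x \<le> 1/2" | "1/2 < x" "x \<le> 3/4" | "3/4 < x" "x < 1" | "x = 1" using x by force
    then show ?thesis
    proof cases
      \<comment> \<open>The fold sends 1 to the midpoint, where \<open>join\<close> evaluates
        \<open>?a\<close> at 1 instead of \<open>?b\<close> at 0.\<close>
      case 4
      then show ?thesis using broken_line_1[OF False, of 0] by (simp add: T_right join_def w2_full_def)
    qed (auto simp: T_left T_right join_def w2_full_def algebra_simps add_divide_distrib diff_divide_distrib)
  qed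
  ultimately have "join ?a (join ?b (\<lambda>x. ?b (1 - x))) \<in> generated" by (rule generated_cong)
  moreover have "join ?a (join ?b (\<lambda>x. ?b (1 - x))) \<doteq> broken_line 0 (A @ B @ rev (map uminus B))"
    by (intro join_broken_line[OF fequiv_refl join_broken_line[OF fequiv_refl broken_line_reverse]]) (use assms False in auto)
  ultimately show ?thesis using generated_fequiv[OF fequiv_sym] by blast
qed

text \<open>The bracketing of \<open>?f\<close> places \<open>?b\<close> on [1/4,1/2], the window of
  \<open>w3_bar\<close>. That map crosses its window three times, on intervals of lengths 1/8, 1/16,
  1/16, and this is the bracketing of the three copies of \<open>?b\<close> in
  \<open>?z\<close>.\<close>

lemma zigzag_in_generated:
  assumes "A \<noteq> []" "B \<noteq> []" "C \<noteq> []"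
    "\<forall>d\<in>set (A @ B @ C). dyadic_step d \<and> 0 < d" "sum_list (A @ B @ C) = 1"
  shows "broken_line 0 (A @ B @ rev (map uminus B) @ B @ C) \<in> generated"
proof -
  let ?a = "broken_line 0 A" and ?b = "broken_line (sum_list A) B" and ?c = "broken_line (sum_list A + sum_list B) C"
  let ?f = "join (join ?a ?b) ?c"
  let ?z = "join (join ?a (join ?b (join (\<lambda>x. ?b (1 - x)) ?b))) ?c"
  have "?f \<doteq> broken_line 0 ((A @ B) @ C)"
    by (intro join_broken_line fequiv_refl) (use assms in \<open>auto intro: fequiv_refl\<close>)
  moreover have "broken_line 0 ((A @ B) @ C) \<in> thompson_F" using assms by (intro broken_line_in_F) auto
  ultimately have "?f \<circ> w3_bar \<in> generated"
    by (intro generated_comp F_subset_generated generated_generator) (auto intro: fequiv_F simp: generator_maps_def)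
  moreover have "?z x = (?f \<circ> w3_bar) x" if x: "x \<in> {0..1}" for x
  proof -
    \<comment> \<open>At 7/16 the zigzag is back at 1/4, where \<open>?f\<close> takes its value
      from \<open>?a\<close> while \<open>?z\<close> takes it from the reversed
      \<open>?b\<close>.\<close>
    have a: "?a 1 = ?b 0" using broken_line_1[OF assms(1), of 0] by simp
    consider "x < 1/4" | "x = 1/4" | "1/4 < x" "x \<le> 3/8" | "3/8 < x" "x < 7/16" | "x = 7/16" | "7/16 < x" "x \<le> 1/2"
      | "1/2 < x" by linarith
    then show ?thesis
      using a by cases (auto simp: w3_bar_def join_def algebra_simps)
  qed
  ultimately have "?z \<in> generated" by (rule generated_cong)
  moreover have "?z \<doteq> broken_line 0 ((A @ B @ rev (map uminus B) @ B) @ C)"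
    by (intro join_broken_line[OF join_broken_line[OF fequiv_refl join_broken_line[OF fequiv_refl join_broken_line[OF broken_line_reverse fequiv_refl]]] fequiv_refl])
       (use assms in \<open>auto simp: sum_list_uminus\<close>)
  ultimately have "broken_line 0 ((A @ B @ rev (map uminus B) @ B) @ C) \<in> generated"
    using generated_fequiv[OF fequiv_sym] by blast
  then show ?thesis by simp
qed

section \<open>Folds and zigzags as walks\<close>

lemma sum_list_increments:
  "m \<le> n \<Longrightarrow> sum_list (map (\<lambda>i. v (Suc i) - v i) [m..<n]) = (v n - v m :: real)"
  by (induction n) (auto simp: le_Suc_eq)

lemma node_increment:
  assumes "i < m"
  shows "dyadic_step (node m (Suc i) - node m i) \<and> 0 < node m (Suc i) - node m i"
proof -
  have "node m (Suc i) - node m i = 1 / 2 ^ (if Suc i < m then Suc i else i)"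
    using assms by (auto simp: node_def field_simps)
  moreover have "dyadic_step (1 / 2 ^ j)" for j :: nat
    unfolding dyadic_step_def by (intro exI[of _ 0] exI[of _ j]) simp
  ultimately show ?thesis by (simp only:) simp
qed

lemma polyline_in_F:
  assumes "0 < n" "v 0 = 0" "v n = 1" "\<And>i. i < n \<Longrightarrow> dyadic_step (v (Suc i) - v i) \<and> 0 < v (Suc i) - v i"
  shows "polyline v n \<in> thompson_F"
  unfolding polyline_def assms(2)
  by (rule broken_line_in_F) (use assms sum_list_increments[of 0 n v] in auto)

lemma upt_split: "i \<le> j \<Longrightarrow> j \<le> k \<Longrightarrow> [i..<k] = [i..<j] @ [j..<k]"
  using upt_add_eq_append[of i j "k - j"] by simp

lemma node_0: "0 < m \<Longrightarrow> node m 0 = 0" and node_self: "node m m = 1"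
  by (auto simp: node_def)

lemma node_increments:
  assumes "0 < m" "ds = map (\<lambda>i. node m (Suc i) - node m i) [0..<m]"
  shows "\<forall>d\<in>set ds. dyadic_step d \<and> 0 < d" "sum_list ds = 1"
  unfolding assms(2) using assms(1) node_increment sum_list_increments[of 0 m "node m"]
  by (auto simp: node_0 node_self)

text \<open>The index \<open>2 * a - i\<close> retraces the last \<open>l\<close> steps before
  \<open>a\<close>, so the increments recur in reverse order with opposite signs.\<close>

lemma increments_reflect:
  fixes f :: "nat \<Rightarrow> real"
  assumes "l \<le> a"
  shows "map (\<lambda>i. f (2 * a - Suc i) - f (2 * a - i)) [a..<a + l] =
    rev (map uminus (map (\<lambda>i. f (Suc i) - f i) [a - l..<a]))"
proof (rule nth_equalityI)
  fix k assume "k < length (map (\<lambda>i. f (2 * a - Suc i) - f (2 * a - i)) [a..<a + l])"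
  then have k: "k < l" by simp
  then have "2 * a - Suc (a + k) = a - l + (l - Suc k)" "2 * a - (a + k) = Suc (a - l + (l - Suc k))"
    using assms by auto
  then show "map (\<lambda>i. f (2 * a - Suc i) - f (2 * a - i)) [a..<a + l] ! k =
    rev (map uminus (map (\<lambda>i. f (Suc i) - f i) [a - l..<a])) ! k"
    using k assms by (simp add: rev_nth)
qed (use assms in simp)

text \<open>The walk climbs to \<open>t\<close> and turns back for \<open>l\<close> steps;
  \<open>A\<close> and \<open>B\<close> are the node increments before and after the index
  \<open>t - l\<close>, and \<open>A\<close> is empty when \<open>l = t\<close>.\<close>

lemma walk_fold_in_generated:
  assumes "0 < l" "l \<le> t"
  shows "polyline (\<lambda>i. node t (if i \<le> t then i else 2 * t - i)) (t + l) \<in> generated"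
proof -
  let ?e = "\<lambda>i. if i \<le> t then i else 2 * t - i"
  let ?d = "\<lambda>i. node t (Suc i) - node t i"
  let ?A = "map ?d [0..<t - l]" and ?B = "map ?d [t - l..<t]"
  have AB: "?A @ ?B = map ?d [0..<t]"
    by (simp only: map_append[symmetric]) (use assms upt_split[of 0 "t - l" t] in simp)
  have "map (\<lambda>i. node t (?e (Suc i)) - node t (?e i)) [0..<t + l] =
    map ?d [0..<t] @ map (\<lambda>i. node t (2 * t - Suc i) - node t (2 * t - i)) [t..<t + l]"
    by (subst upt_add_eq_append) auto
  also have "\<dots> = ?A @ ?B @ rev (map uminus ?B)"
    using assms by (simp only: increments_reflect AB[symmetric] append_assoc)
  finally have "polyline (\<lambda>i. node t (?e i)) (t + l) = broken_line 0 (?A @ ?B @ rev (map uminus ?B))"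
    using assms by (simp add: polyline_def node_def del: map_map)
  moreover have "broken_line 0 (?A @ ?B @ rev (map uminus ?B)) \<in> generated"
    using node_increments[OF _ AB] assms by (intro fold_in_generated) auto
  ultimately show ?thesis by simp
qed

text \<open>The walk climbs to \<open>a\<close>, falls back to \<open>a - l\<close> and climbs on to
  \<open>n\<close>. The strict inequalities make all three lists \<open>A\<close>, \<open>B\<close>,
  \<open>C\<close> nonempty.\<close>

lemma walk_zigzag_in_generated:
  assumes "0 < l" "l < a" "a < n"
  shows "polyline (\<lambda>i. node n (if i \<le> a then i else if i \<le> a + l then 2 * a - i else i - 2 * l)) (n + 2 * l) \<in> generated"
proof -
  let ?z = "\<lambda>i. if i \<le> a then i else if i \<le> a + l then 2 * a - i else i - 2 * l"
  let ?d = "\<lambda>i. node n (Suc i) - node n i"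
  let ?g = "\<lambda>i. node n (?z (Suc i)) - node n (?z i)"
  let ?A = "map ?d [0..<a - l]" and ?B = "map ?d [a - l..<a]" and ?C = "map ?d [a..<n]"
  have AB: "?A @ ?B = map ?d [0..<a]"
    by (simp only: map_append[symmetric]) (use assms upt_split[of 0 "a - l" a] in simp)
  have ABC: "?A @ ?B @ ?C = map ?d [0..<n]"
    unfolding append_assoc[symmetric] AB
    by (simp only: map_append[symmetric]) (use assms upt_split[of 0 a n] in simp)
  have 1: "[0..<n + 2 * l] = [0..<a] @ [a..<a + l] @ [a + l..<a + 2 * l] @ [a + 2 * l..<n + 2 * l]"
    using assms upt_split[of 0 a "n + 2 * l"] upt_split[of a "a + l" "n + 2 * l"]
      upt_split[of "a + l" "a + 2 * l" "n + 2 * l"] by simp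
  have 2: "map ?g [0..<a] = ?A @ ?B" unfolding AB by simp
  have 3: "map ?g [a..<a + l] = rev (map uminus ?B)"
    using assms by (subst increments_reflect[symmetric]) auto
  have 4: "map ?g [a + l..<a + 2 * l] = ?B"
  proof (rule nth_equalityI)
    fix k assume "k < length (map ?g [a + l..<a + 2 * l])"
    then have "k < l" by simp
    then show "map ?g [a + l..<a + 2 * l] ! k = ?B ! k"
      \<comment> \<open>For \<open>k = 0\<close> the index \<open>a + l\<close> still belongs to the
        middle branch of \<open>?z\<close>, whose value there is also \<open>a - l\<close>.\<close>
      using assms by (cases k) (auto intro!: arg_cong2[where f = minus] arg_cong[where f = "node n"])
  qed (use assms in simp)
  have 5: "map ?g [a + 2 * l..<n + 2 * l] = ?C"
    using assms by (intro nth_equalityI) (auto intro!: arg_cong2[where f = minus] arg_cong[where f = "node n"])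
  have "polyline (\<lambda>i. node n (?z i)) (n + 2 * l) = broken_line 0 (?A @ ?B @ rev (map uminus ?B) @ ?B @ ?C)"
    unfolding polyline_def 1 map_append 2 3 4 5 using assms by (simp add: node_def del: map_map)
  moreover have "broken_line 0 (?A @ ?B @ rev (map uminus ?B) @ ?B @ ?C) \<in> generated"
    using node_increments[OF _ ABC] assms by (intro zigzag_in_generated) auto
  ultimately show ?thesis by simp
qed

lemma polyline_reverse:
  assumes "0 < n"
  shows "(\<lambda>x. polyline v n (1 - x)) \<doteq> polyline (\<lambda>i. v (n - i)) n"
proof -
  have "map (\<lambda>i. v (n - Suc i) - v (n - i)) [0..<n] = rev (map uminus (map (\<lambda>i. v (Suc i) - v i) [0..<n]))"
    by (rule nth_equalityI) (auto simp: rev_nth Suc_diff_Suc)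
  then show ?thesis
    using broken_line_reverse[of "map (\<lambda>i. v (Suc i) - v i) [0..<n]" "v 0"] assms sum_list_increments[of 0 n v]
    by (simp add: polyline_def del: map_map)
qed

lemma polyline_reverse_generated:
  assumes "0 < n" "polyline (\<lambda>i. v (n - i)) n \<in> generated"
  shows "polyline v n \<in> generated"
proof -
  have "(\<lambda>x. polyline v n (1 - x)) \<in> generated" using generated_fequiv[OF polyline_reverse] assms by blast
  moreover have "g0_minus \<in> generated" by (rule generated_generator) (simp add: generator_maps_def)
  ultimately have "(\<lambda>x. polyline v n (1 - x)) \<circ> g0_minus \<in> generated" by (rule generated_comp)
  then show ?thesis by (rule generated_cong) (simp add: g0_minus_def)
qed

section \<open>Reduction of walks\<close>

definition onto_walk :: "nat \<Rightarrow> (nat \<Rightarrow> nat) \<Rightarrow> nat \<Rightarrow> bool" where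
  "onto_walk m w n \<longleftrightarrow> walk w n \<and> (\<forall>i\<le>n. w i \<le> m) \<and> (\<exists>i\<le>n. w i = 0) \<and> (\<exists>i\<le>n. w i = m)"

text \<open>Only interior reversals of direction count; the two ends of the walk are not
  turns.\<close>

definition turn :: "(nat \<Rightarrow> nat) \<Rightarrow> nat \<Rightarrow> nat \<Rightarrow> bool" where
  "turn w n i \<longleftrightarrow> 0 < i \<and> i < n \<and> w (i - 1) = w (i + 1)"

lemma walk_monotone:
  assumes "walk w n" "\<And>i. \<not> turn w n i"
  shows "(\<exists>c. \<forall>i\<le>n. w i = c + i) \<or> (\<exists>c. \<forall>i\<le>n. w i + i = c)"
  using assms
proof (induction n)
  case (Suc n)
  have "\<not> turn w n i" for i using Suc.prems(2)[of i] by (auto simp: turn_def)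
  then have IH: "(\<exists>c. \<forall>i\<le>n. w i = c + i) \<or> (\<exists>c. \<forall>i\<le>n. w i + i = c)"
    using Suc.IH Suc.prems(1) by (auto simp: walk_def)
  show ?case
  proof (cases n)
    case 0
    then show ?thesis using Suc.prems(1) by (auto simp: walk_def le_Suc_eq)
  next
    case (Suc k)
    have step: "w (Suc n) = Suc (w n) \<or> w n = Suc (w (Suc n))" "w k \<noteq> w (Suc n)"
      using Suc.prems(1) Suc.prems(2)[of n] Suc by (auto simp: walk_def turn_def)
    from IH show ?thesis
    proof (elim disjE exE)
      fix c assume c: "\<forall>i\<le>n. w i = c + i"
      then have "w k = c + k" "w n = c + n" using Suc by auto
      then have "w (Suc n) = c + Suc n" using step Suc by auto
      then have "\<forall>i\<le>Suc n. w i = c + i" using c by (auto simp: le_Suc_eq)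
      then show ?thesis by blast
    next
      fix c assume c: "\<forall>i\<le>n. w i + i = c"
      then have "w k + k = c" "w n + n = c" using Suc by auto
      then have "w (Suc n) + Suc n = c" using step Suc by auto
      then have "\<forall>i\<le>Suc n. w i + i = c" using c by (auto simp: le_Suc_eq)
      then show ?thesis by blast
    qed
  qed
qed simp

text \<open>No other turn is closer to \<open>c\<close> than \<open>l\<close>, so on both sides the
  walk leaves \<open>w c\<close> in the same direction and keeps that direction for \<open>l\<close>
  steps.\<close>

lemma walk_symmetric:
  assumes "walk w n" "turn w n c" "l \<le> c" "c + l \<le> n"
    "\<And>i. turn w n i \<Longrightarrow> i < c \<Longrightarrow> i + l \<le> c" "\<And>i. turn w n i \<Longrightarrow> c < i \<Longrightarrow> c + l \<le> i"
    "j \<le> l"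
  shows "w (c + j) = w (c - j)"
  using assms(7)
proof (induction j rule: less_induct)
  case (less j)
  consider "j = 0" | "j = 1" | k where "j = Suc (Suc k)"
    by (metis One_nat_def not0_implies_Suc)
  then show ?case
  proof cases
    case 2
    then show ?thesis using assms(2) by (auto simp: turn_def)
  next
    case 3
    have IH: "w (c + Suc k) = w (c - Suc k)" "w (c + k) = w (c - k)"
      using less.IH[of "Suc k"] less.IH[of k] less.prems 3 by auto
    define a b where "a = c + k" and "b = c - Suc (Suc k)"
    have b: "c - k = Suc (Suc b)" "c - Suc k = Suc b" using less.prems assms(3) 3 by (auto simp: b_def)
    have c: "c = b + Suc (Suc k)" "Suc (Suc k) \<le> l" using less.prems assms(3) 3 by (auto simp: b_def)
    have "\<not> turn w n (Suc a)" using assms(6)[of "Suc a"] c(2) by (auto simp: a_def)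
    moreover have "\<not> turn w n (Suc b)" using assms(5)[of "Suc b"] c by auto
    moreover have lt: "Suc a < n" "Suc b < n" "a < n" "b < n"
      using less.prems 3 assms(3,4) by (auto simp: a_def b_def)
    ultimately have ne: "w a \<noteq> w (Suc (Suc a))" "w b \<noteq> w (Suc (Suc b))" by (auto simp: turn_def)
    have step: "w (Suc i) = Suc (w i) \<or> w i = Suc (w (Suc i))" if "i < n" for i
      using assms(1) that by (simp add: walk_def)
    have eq: "w (Suc a) = w (Suc b)" "w a = w (Suc (Suc b))" using IH b by (auto simp: a_def)
    have "w (Suc (Suc a)) = w b"
      \<comment> \<open>On either side the next value is a unit step that does not go back, so it is
        determined by the two preceding values, which agree by induction.\<close>
      using step[OF lt(1)] step[OF lt(2)] step[OF lt(3)] step[OF lt(4)] ne eq by linarith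
    then show ?thesis using 3 by (simp add: a_def b_def)
  qed simp
qed

lemma onto_walk_pos: "onto_walk m w n \<Longrightarrow> 0 < m \<Longrightarrow> 0 < n"
  by (auto simp: onto_walk_def intro!: gr0I)

lemma onto_walk_reverse:
  assumes "onto_walk m w n"
  shows "onto_walk m (\<lambda>i. w (n - i)) n"
proof -
  have "w (n - Suc i) = Suc (w (n - i)) \<or> w (n - i) = Suc (w (n - Suc i))" if "i < n" for i
  proof -
    have "w (Suc (n - Suc i)) = Suc (w (n - Suc i)) \<or> w (n - Suc i) = Suc (w (Suc (n - Suc i)))"
      using assms that by (auto simp: onto_walk_def walk_def)
    then show ?thesis using Suc_diff_Suc[OF that] by auto
  qed
  then have "walk (\<lambda>i. w (n - i)) n" unfolding walk_def by blast
  moreover have "\<exists>i\<le>n. w (n - i) = k" if k: "\<exists>i\<le>n. w i = k" for k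
  proof -
    obtain i where "i \<le> n" "w i = k" using k by blast
    then show ?thesis by (intro exI[of _ "n - i"]) simp
  qed
  moreover have "\<forall>i\<le>n. w (n - i) \<le> m" using assms by (simp add: onto_walk_def)
  ultimately show ?thesis using assms unfolding onto_walk_def by blast
qed

text \<open>A value taken after \<open>t\<close> is also taken at the index mirrored in
  \<open>t\<close>, so both ends remain visited when the folded tail is cut off.\<close>

lemma onto_walk_restrict:
  assumes "onto_walk m w n" "t \<le> n" "n - t \<le> t" "\<And>j. j \<le> n - t \<Longrightarrow> w (t + j) = w (t - j)"
  shows "onto_walk m w t"
proof -
  have "\<exists>i\<le>t. w i = k" if k: "\<exists>i\<le>n. w i = k" for k
  proof -
    obtain i where i: "i \<le> n" "w i = k" using k by blast
    show ?thesis
    proof (cases "i \<le> t")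
      case False
      then have t: "t + (i - t) = i" by simp
      have "w (t + (i - t)) = w (t - (i - t))" using i by (intro assms(4)) simp
      then have "w (t - (i - t)) = k" unfolding t i(2) by (rule sym)
      then show ?thesis by (intro exI[of _ "t - (i - t)"]) simp
    next
      case True
      then show ?thesis using i by blast
    qed
  qed
  then have "\<exists>i\<le>t. w i = 0" "\<exists>i\<le>t. w i = m"
    using assms(1) unfolding onto_walk_def by blast+
  then show ?thesis using assms(1,2) by (simp add: onto_walk_def walk_def)
qed

text \<open>Mirror symmetry gives \<open>v (?e i) = v i\<close>, which exhibits the polyline as its
  restriction to the first \<open>t\<close> steps composed with a fold.\<close>

lemma polyline_fold_generated:
  assumes "polyline v t \<in> generated" "t < n" "n - t \<le> t" "\<And>j. j \<le> n - t \<Longrightarrow> v (t + j) = v (t - j)"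
  shows "polyline v n \<in> generated"
proof -
  let ?e = "\<lambda>i. if i \<le> t then i else 2 * t - i"
  have e: "polyline (\<lambda>i. node t (?e i)) n \<in> generated"
    using walk_fold_in_generated[of "n - t" t] assms(2,3) by simp
  have "polyline v t (polyline (\<lambda>i. node t (?e i)) n x) = polyline v n x" if "x \<in> {0..1}" for x
  proof -
    have "polyline v t (polyline (\<lambda>i. node t (?e i)) n x) = polyline (\<lambda>i. v (?e i)) n x"
      using assms(2,3) that by (intro polyline_comp_walk) (auto simp: walk_def)
    also have "\<dots> = polyline v n x"
    proof (intro fun_cong[OF polyline_cong])
      fix i assume "i \<le> n"
      then show "v (?e i) = v i"
        using assms(4)[of "i - t"] by (auto simp: mult_2)
    qed
    finally show ?thesis .
  qed
  then show ?thesis using generated_cong[OF generated_comp[OF assms(1) e]] by simp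
qed

lemma monotone_walk_in_generated:
  assumes "onto_walk m w n" "0 < m" "\<And>i. \<not> turn w n i"
  shows "polyline (\<lambda>i. node m (w i)) n \<in> generated"
proof -
  have w: "\<forall>i\<le>n. w i \<le> m" "\<exists>i\<le>n. w i = 0" "\<exists>i\<le>n. w i = m" "walk w n"
    using assms(1) by (auto simp: onto_walk_def)
  have id: "polyline (\<lambda>i. node m i) m \<in> generated"
    using assms(2) by (intro F_subset_generated polyline_in_F node_increment) (auto simp: node_0 node_self)
  from walk_monotone[OF w(4) assms(3)] show ?thesis
  proof (elim disjE exE)
    fix c assume up: "\<forall>i\<le>n. w i = c + i"
    then have "c = 0" using w(2) by auto
    then have wi: "w i = i" if "i \<le> n" for i using up that by simp
    have "n = m" using wi w(1,3) by force
    then have "polyline (\<lambda>i. node m (w i)) n = polyline (\<lambda>i. node m i) m"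
      using wi by (auto intro: polyline_cong)
    then show ?thesis using id by simp
  next
    fix c assume down: "\<forall>i\<le>n. w i + i = c"
    obtain i j where ij: "i \<le> n" "w i = 0" "j \<le> n" "w j = m" using w(2,3) by blast
    have "w i + i = c" "w j + j = c" "w 0 + 0 = c" "w n + n = c" "w 0 \<le> m"
      using down w(1) ij by blast+
    then have "n = m" "c = m" using ij by linarith+
    have "polyline (\<lambda>i. node m (w (n - i))) n = polyline (\<lambda>i. node m i) m"
      unfolding \<open>n = m\<close>
    proof (rule polyline_cong)
      fix i assume "i \<le> m"
      then have "w (m - i) + (m - i) = m" using down \<open>c = m\<close> \<open>n = m\<close> by (metis diff_le_self)
      then show "node m (w (m - i)) = node m i" using \<open>i \<le> m\<close> by (intro arg_cong[where f = "node m"]) linarith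
    qed
    then have "polyline (\<lambda>i. node m (w (n - i))) n \<in> generated" using id by simp
    then show ?thesis
      by (rule polyline_reverse_generated[rotated, where v = "\<lambda>i. node m (w i)"]) (use assms(2) \<open>n = m\<close> in simp)
  qed
qed

lemma onto_walk_in_generated:
  assumes "onto_walk m w n" "0 < m"
  shows "polyline (\<lambda>i. node m (w i)) n \<in> generated"
  using assms(1)
proof (induction n arbitrary: w rule: less_induct)
  case (less n)
  have n: "0 < n" using less.prems assms(2) by (rule onto_walk_pos)
  have walk: "walk w n" using less.prems by (simp add: onto_walk_def)
  have fold: "polyline (\<lambda>i. node m (w' i)) n \<in> generated"
    if "onto_walk m w' n" "t < n" "n - t \<le> t" "\<And>j. j \<le> n - t \<Longrightarrow> w' (t + j) = w' (t - j)" for w' t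
  proof (rule polyline_fold_generated[of _ t])
    show "polyline (\<lambda>i. node m (w' i)) t \<in> generated"
      using that by (intro less.IH onto_walk_restrict[of m w' n t]) auto
  qed (use that in auto)
  \<comment> \<open>Critical indices are the turns and the two ends. A least gap between any two of
    them is the length of a shortest monotone run.\<close>
  define crit where "crit i \<longleftrightarrow> i = 0 \<or> i = n \<or> turn w n i" for i
  define gap where "gap l \<longleftrightarrow> 0 < l \<and> (\<exists>a. crit a \<and> crit (a + l) \<and> a + l \<le> n)" for l
  have "gap n" using n by (auto simp: gap_def crit_def intro!: exI[of _ 0])
  define l where "l = (LEAST l. gap l)"
  have "gap l" unfolding l_def by (rule LeastI) fact
  then obtain a where a: "0 < l" "crit a" "crit (a + l)" "a + l \<le> n" by (auto simp: gap_def)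
  have sep: "i + l \<le> j" if "crit i" "crit j" "i < j" "j \<le> n" for i j
  proof -
    have "gap (j - i)" using that by (auto simp: gap_def intro!: exI[of _ i])
    then have "l \<le> j - i" unfolding l_def by (rule Least_le)
    then show ?thesis using that(3) by simp
  qed
  have turn_crit: "crit i \<and> 0 < i \<and> i < n" if "turn w n i" for i
    using that by (auto simp: crit_def turn_def)
  have sym: "w (c + j) = w (c - j)" if "turn w n c" "j \<le> l" for c j
  proof (rule walk_symmetric[OF walk that(1) _ _ _ _ that(2)])
    show "l \<le> c" using sep[of 0 c] turn_crit[OF that(1)] by (auto simp: crit_def)
    show "c + l \<le> n" using sep[of c n] turn_crit[OF that(1)] by (auto simp: crit_def)
    show "i + l \<le> c" if "turn w n i" "i < c" for i
      using sep[of i c] turn_crit[OF that(1)] turn_crit[OF \<open>turn w n c\<close>] that by auto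
    show "c + l \<le> i" if "turn w n i" "c < i" for i
      using sep[of c i] turn_crit[OF that(1)] turn_crit[OF \<open>turn w n c\<close>] that by auto
  qed
  \<comment> \<open>A shortest run between two turns has \<open>l \<le> a\<close> and
    \<open>a + l + l \<le> n\<close>. In the cases of equality a neighbouring run of the same length
    reaches an end, and they are absorbed into \<open>left\<close> and \<open>right\<close>.\<close>
  consider (mono) "a = 0" "a + l = n" | (right) c where "turn w n c" "c + l = n" | (left) "turn w n l"
    | (mid) "turn w n a" "turn w n (a + l)" "l < a" "a + l + l < n"
  proof -
    have "a = 0 \<or> turn w n a" "a + l = n \<or> turn w n (a + l)"
      using a by (auto simp: crit_def)
    moreover have "l \<le> a" if "turn w n a" using sep[of 0 a] turn_crit[OF that] by (auto simp: crit_def)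
    moreover have "a + l + l \<le> n" if "turn w n (a + l)"
      using sep[of "a + l" n] turn_crit[OF that] by (auto simp: crit_def)
    ultimately show ?thesis using that by (metis add_0 le_neq_implies_less)
  qed
  then show ?case
  proof cases
    case mono
    have "\<not> turn w n i" for i
      using sep[of 0 i] turn_crit[of i] mono by (auto simp: crit_def)
    then show ?thesis by (rule monotone_walk_in_generated[OF less.prems assms(2)])
  next
    case right
    have "l \<le> c" using sep[of 0 c] turn_crit[OF right(1)] by (auto simp: crit_def)
    then show ?thesis
      using right a(1) sym[OF right(1)] by (intro fold[of w c] less.prems) auto
  next
    case left
    have "l + l \<le> n" using sep[of l n] turn_crit[OF left] by (auto simp: crit_def)
    \<comment> \<open>Reversing the walk moves the fold at its beginning to its end.\<close>
    have "polyline (\<lambda>i. node m (w (n - i))) n \<in> generated"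
    proof (rule fold[of _ "n - l"])
      show "onto_walk m (\<lambda>i. w (n - i)) n" using less.prems by (rule onto_walk_reverse)
      show "w (n - (n - l + j)) = w (n - (n - l - j))" if "j \<le> n - (n - l)" for j
      proof -
        have "n - (n - l + j) = l - j" "n - (n - l - j) = l + j" "j \<le> l"
          using that \<open>l + l \<le> n\<close> by auto
        then show ?thesis using sym[OF left] by simp
      qed
    qed (use a(1) n \<open>l + l \<le> n\<close> in auto)
    then show ?thesis by (rule polyline_reverse_generated[OF n])
  next
    case mid
    let ?k = "n - 2 * l"
    \<comment> \<open>\<open>?u\<close> cuts the \<open>2 * l\<close> steps after \<open>a\<close>
      out of the walk; composing with the zigzag \<open>?z\<close> puts them back.\<close>
    let ?u = "\<lambda>i. if i \<le> a then w i else w (i + 2 * l)"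
    let ?z = "\<lambda>i. if i \<le> a then i else if i \<le> a + l then 2 * a - i else i - 2 * l"
    have k: "a < ?k" "?k < n" "n = ?k + 2 * l" using mid a(1) by auto
    have sym_a: "w (a + j) = w (a - j)" and sym_b: "w (a + l + j) = w (a + l - j)" if "j \<le> l" for j
      using that sym mid by blast+
    have uz: "?u (?z i) = w i" for i
    proof -
      consider "i \<le> a" | "a < i" "i \<le> a + l" | "a + l < i" "i \<le> a + 2 * l" | "a + 2 * l < i" by linarith
      then show ?thesis
      proof cases
        case 2
        then show ?thesis using sym_a[of "i - a"] mid(3) by (auto simp: mult_2)
      next
        case 3
        \<comment> \<open>Reflection in \<open>a + l\<close> followed by reflection in
          \<open>a\<close> is the translation by \<open>- 2 * l\<close>.\<close>
        have "w i = w (a + l - (i - (a + l)))" using sym_b[of "i - (a + l)"] 3 by auto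
        also have "a + l - (i - (a + l)) = a + (2 * l - (i - a))" using 3 by auto
        also have "w \<dots> = w (a - (2 * l - (i - a)))" using 3 by (intro sym_a) auto
        also have "a - (2 * l - (i - a)) = i - 2 * l" using 3 mid(3) by auto
        finally show ?thesis using 3 mid(3) by auto
      qed auto
    qed
    have zk: "?z i \<le> ?k" if "i \<le> n" for i using that k mid by auto
    \<comment> \<open>The walk has the same value before and after the cut, so \<open>?u\<close>
      still makes a unit step there.\<close>
    have wa: "w (a + 2 * l) = w a" using uz[of "a + 2 * l"] a(1) by simp
    have "onto_walk m ?u ?k"
      unfolding onto_walk_def
    proof (intro conjI)
      have "?u (Suc i) = Suc (?u i) \<or> ?u i = Suc (?u (Suc i))" if "i < ?k" for i
      proof -
        have "i < n" "i + 2 * l < n" using that by auto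
        then have "w (Suc i) = Suc (w i) \<or> w i = Suc (w (Suc i))"
          "w (Suc (i + 2 * l)) = Suc (w (i + 2 * l)) \<or> w (i + 2 * l) = Suc (w (Suc (i + 2 * l)))"
          using walk by (auto simp: walk_def)
        then show ?thesis using wa by (cases "i = a") auto
      qed
      then show "walk ?u ?k" by (simp add: walk_def)
      show "\<forall>i\<le>?k. ?u i \<le> m" using less.prems k by (auto simp: onto_walk_def)
      have "\<exists>i\<le>?k. ?u i = y" if "\<exists>i\<le>n. w i = y" for y
        using that uz zk by metis
      then show "\<exists>i\<le>?k. ?u i = 0" "\<exists>i\<le>?k. ?u i = m"
        using less.prems by (auto simp: onto_walk_def)
    qed
    then have "polyline (\<lambda>i. node m (?u i)) ?k \<in> generated" by (rule less.IH[OF k(2)])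
    moreover have "polyline (\<lambda>i. node ?k (?z i)) n \<in> generated"
      using walk_zigzag_in_generated[OF a(1) mid(3) k(1)] k(3) by simp
    ultimately have "polyline (\<lambda>i. node m (?u i)) ?k \<circ> polyline (\<lambda>i. node ?k (?z i)) n \<in> generated" by (rule generated_comp)
    moreover have "polyline (\<lambda>i. node m (w i)) n x = (polyline (\<lambda>i. node m (?u i)) ?k \<circ> polyline (\<lambda>i. node ?k (?z i)) n) x"
      if "x \<in> {0..1}" for x
    proof -
      have "walk ?z n" using mid a(1) by (auto simp: walk_def)
      then have "polyline (\<lambda>i. node m (?u i)) ?k (polyline (\<lambda>i. node ?k (?z i)) n x) = polyline (\<lambda>i. node m (?u (?z i))) n x"
        using k zk n that by (intro polyline_comp_walk[where v = "\<lambda>i. node m (?u i)"]) auto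
      then show ?thesis by (simp only: uz o_apply)
    qed
    ultimately show ?thesis by (rule generated_cong)
  qed
qed

section \<open>From the Thompson monoid to walks\<close>

lemma F_image:
  assumes "f \<in> thompson_F"
  shows "f ` {0..1} = {0..1}"
proof
  show "f ` {0..1} \<subseteq> {0..1}" using F_in_unit[OF assms] by blast
  obtain k where k: "k \<in> thompson_F" "\<forall>x\<in>{0..1}. k (f x) = x \<and> f (k x) = x"
    using F_inverse[OF assms] by blast
  show "{0..1} \<subseteq> f ` {0..1}"
  proof
    fix x :: real assume x: "x \<in> {0..1}"
    have "x = f (k x)" using k(2) x by simp
    then show "x \<in> f ` {0..1}" using F_in_unit[OF k(1) x] by (rule image_eqI)
  qed
qed

text \<open>The values differ by multiples of \<open>1 / 2 ^ N\<close> and one of them is 0, so they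
  are \<open>w i / 2 ^ N\<close> for a walk \<open>w\<close> that visits both ends. The nodes are
  carried to this equidistant grid by an element of the group.\<close>

lemma uniform_polyline_in_generated:
  assumes "0 < n" "\<And>i. i < n \<Longrightarrow> \<bar>v (Suc i) - v i\<bar> = 1 / 2 ^ N" "polyline v n ` {0..1} = {0..1}"
  shows "polyline v n \<in> generated"
proof -
  have v01: "v i \<in> {0..1}" if "i \<le> n" for i
    using polyline_node[OF assms(1) that, of v] node_unit[of n i] assms(3) by (metis imageI)
  have attained: "\<exists>i\<le>n. v i = y" if "y = 0 \<or> y = 1" for y
  proof -
    have "y \<in> polyline v n ` {0..1}" unfolding assms(3) using that by auto
    then obtain x where x: "x \<in> {0..1}" "polyline v n x = y" by blast
    obtain i t where i: "i < n" "t \<in> {0..1}" "y = v i + (v (Suc i) - v i) * t"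
      using polyline_value[OF assms(1) x(1), of v] x(2) by auto
    have v: "v i \<in> {0..1}" "v (Suc i) \<in> {0..1}" using i(1) by (intro v01; simp)+
    have y: "y = (1 - t) * v i + t * v (Suc i)" using i(3) by (simp add: algebra_simps)
    \<comment> \<open>The extreme values 0 and 1 of a convex combination of points of the unit
      interval are attained at one of these points.\<close>
    have "v i = y \<or> v (Suc i) = y"
    proof (rule disjE[OF that])
      assume "y = 0"
      then have "(1 - t) * v i = 0" "t * v (Suc i) = 0"
        using y v i(2) by (auto simp: add_nonneg_eq_0_iff)
      then show ?thesis using \<open>y = 0\<close> by auto
    next
      assume "y = 1"
      then have "(1 - t) * (1 - v i) + t * (1 - v (Suc i)) = 0" using y by (simp add: algebra_simps)
      then have "(1 - t) * (1 - v i) = 0" "t * (1 - v (Suc i)) = 0"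
        using v i(2) by (auto simp: add_nonneg_eq_0_iff)
      then show ?thesis using \<open>y = 1\<close> by auto
    qed
    then show ?thesis using i(1) by (metis Suc_leI less_imp_le)
  qed
  have diff: "\<exists>k::int. v i - v 0 = k / 2 ^ N" if "i \<le> n" for i
    using that
  proof (induction i)
    case 0
    then show ?case by (intro exI[of _ 0]) simp
  next
    case (Suc i)
    then obtain k :: int where k: "v i - v 0 = k / 2 ^ N" by auto
    have "\<bar>v (Suc i) - v i\<bar> = 1 / 2 ^ N" using assms(2) Suc.prems by simp
    then have "v (Suc i) - v 0 = (k + 1) / 2 ^ N \<or> v (Suc i) - v 0 = (k - 1) / 2 ^ N"
      using k by (auto simp: abs_if add_divide_distrib diff_divide_distrib split: if_splits)
    then show ?case by (metis of_int_1 of_int_add of_int_diff)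
  qed
  obtain i0 where i0: "i0 \<le> n" "v i0 = 0" using attained by blast
  obtain k0 :: int where k0: "v i0 - v 0 = k0 / 2 ^ N" using diff[OF i0(1)] by blast
  have "\<exists>k::nat. v i = k / 2 ^ N" if i: "i \<le> n" for i
  proof -
    obtain k :: int where "v i - v 0 = k / 2 ^ N" using diff[OF i] by blast
    then have "v i = (k - k0) / 2 ^ N" using k0 i0 by (simp add: diff_divide_distrib)
    then have "v i * 2 ^ N = of_int (k - k0)" by simp
    moreover have "0 \<le> v i * 2 ^ N" using v01[OF i] by simp
    ultimately have "v i * 2 ^ N = real (nat (k - k0))" by simp
    then have "v i = real (nat (k - k0)) / 2 ^ N" by (simp add: field_simps)
    then show ?thesis by blast
  qed
  then obtain w :: "nat \<Rightarrow> nat" where w: "\<And>i. i \<le> n \<Longrightarrow> v i = w i / 2 ^ N" by metis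
  let ?q = "\<lambda>i. real i / 2 ^ N"
  have "walk w n"
    unfolding walk_def
  proof (intro allI impI)
    fix i assume i: "i < n"
    then have "\<bar>(real (w (Suc i)) - real (w i)) / 2 ^ N\<bar> = 1 / 2 ^ N"
      using assms(2)[OF i] w[of i] w[of "Suc i"] by (simp add: diff_divide_distrib)
    then have "\<bar>real (w (Suc i)) - real (w i)\<bar> = 1" by (simp add: abs_divide)
    then show "w (Suc i) = Suc (w i) \<or> w i = Suc (w (Suc i))" by linarith
  qed
  moreover have le: "w i \<le> 2 ^ N" if i: "i \<le> n" for i
  proof -
    have "real (w i) \<le> real (2 ^ N)" using v01[OF i] w[OF i] by (simp add: field_simps)
    then show ?thesis by (simp only: of_nat_le_iff)
  qed
  moreover have "\<exists>i\<le>n. w i = 0" using i0 w by auto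
  moreover have "\<exists>i\<le>n. w i = 2 ^ N"
  proof -
    obtain i where i: "i \<le> n" "v i = 1" using attained by blast
    then have "real (w i) = real (2 ^ N)" using w[of i] by (simp add: field_simps)
    then show ?thesis using i(1) by (auto simp only: of_nat_eq_iff)
  qed
  ultimately have walk: "walk w n" and "onto_walk (2 ^ N) w n" by (auto simp: onto_walk_def)
  then have "polyline (\<lambda>i. node (2 ^ N) (w i)) n \<in> generated" by (intro onto_walk_in_generated) auto
  moreover have "polyline ?q (2 ^ N) \<in> thompson_F"
    by (intro polyline_in_F) (auto simp: dyadic_step_def diff_divide_distrib[symmetric] intro: exI[of _ 0])
  ultimately have "polyline ?q (2 ^ N) \<circ> polyline (\<lambda>i. node (2 ^ N) (w i)) n \<in> generated"
    using generated_comp[OF F_subset_generated] by blast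
  moreover have "polyline v n x = (polyline ?q (2 ^ N) \<circ> polyline (\<lambda>i. node (2 ^ N) (w i)) n) x" if "x \<in> {0..1}" for x
  proof -
    have "polyline ?q (2 ^ N) (polyline (\<lambda>i. node (2 ^ N) (w i)) n x) = polyline (\<lambda>i. ?q (w i)) n x"
      using assms(1) walk le that by (intro polyline_comp_walk) auto
    also have "\<dots> = polyline v n x" using w by (intro fun_cong[OF polyline_cong]) simp
    finally show ?thesis by simp
  qed
  ultimately show ?thesis by (rule generated_cong)
qed

text \<open>Halving brings all increments to a common size. It changes the map only by a
  reparametrisation, which preserves the image.\<close>

lemma dyadic_polyline_in_generated:
  assumes "0 < n" "\<And>i. i < n \<Longrightarrow> dyadic_step (v (Suc i) - v i)" "polyline v n ` {0..1} = {0..1}"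
  shows "polyline v n \<in> generated"
proof -
  let ?ds = "map (\<lambda>i. v (Suc i) - v i) [0..<n]"
  obtain N :: nat where "\<forall>d\<in>set ?ds. \<exists>k::nat. \<bar>d\<bar> = 2 ^ k * (1 / 2 ^ N)"
    using dyadic_step_common[of ?ds] assms(2) by auto
  then obtain es where es: "es \<noteq> []" "polyline v n \<doteq> broken_line (v 0) es" "\<forall>x\<in>set es. \<bar>x\<bar> = 1 / 2 ^ N"
    using broken_line_refine[of ?ds "1 / 2 ^ N" "v 0"] assms(1) unfolding polyline_def by auto
  \<comment> \<open>Partial sums turn the refined increments back into a list of values.\<close>
  define u where "u i = v 0 + sum_list (take i es)" for i
  have inc: "u (Suc i) - u i = es ! i" if "i < length es" for i
    using that by (simp add: u_def take_Suc_conv_app_nth)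
  have "map (\<lambda>i. u (Suc i) - u i) [0..<length es] = es"
    by (rule nth_equalityI) (auto simp: inc)
  then have u: "polyline u (length es) = broken_line (v 0) es" by (simp add: polyline_def u_def)
  obtain h where h: "h \<in> thompson_F" "\<forall>x\<in>{0..1}. polyline v n x = polyline u (length es) (h x)"
    using es(2) unfolding fequiv_def u by blast
  obtain k where k: "k \<in> thompson_F" "\<forall>x\<in>{0..1}. polyline u (length es) x = polyline v n (k x)"
    using fequiv_sym[OF es(2)] unfolding fequiv_def u by blast
  have "polyline u (length es) \<in> generated"
  proof (rule uniform_polyline_in_generated)
    show "\<bar>u (Suc i) - u i\<bar> = 1 / 2 ^ N" if "i < length es" for i
      using es(3) that by (simp add: inc)
    have "polyline u (length es) ` {0..1} \<subseteq> polyline v n ` {0..1}" using k F_in_unit by (metis imageI image_subsetI)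
    moreover have "polyline v n ` {0..1} \<subseteq> polyline u (length es) ` {0..1}" using h F_in_unit by (metis imageI image_subsetI)
    ultimately show "polyline u (length es) ` {0..1} = {0..1}" using assms(3) by blast
  qed (use es(1) in simp)
  then show ?thesis using generated_fequiv es(2) u by metis
qed

section \<open>Dyadic grids adapted to a map of the monoid\<close>

definition affine_partition :: "(real \<Rightarrow> real) \<Rightarrow> real set \<Rightarrow> bool" where
  "affine_partition g P \<longleftrightarrow> finite P \<and> {0, 1} \<subseteq> P \<and> P \<subseteq> {0..1} \<and>
     (\<forall>a\<in>P. \<forall>b\<in>P. a < b \<and> {a<..<b} \<inter> P = {} \<longrightarrow> (\<exists>m c. \<forall>x\<in>{a..b}. g x = m * x + c))"

lemma affine_partition_neighbours:
  assumes "affine_partition g P" "0 \<le> x" "x < 1"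
  obtains a b where "a \<in> P" "b \<in> P" "a \<le> x" "x < b" "{a<..<b} \<inter> P = {}"
proof
  have P: "finite P" "0 \<in> P" "1 \<in> P" using assms(1) by (auto simp: affine_partition_def)
  let ?A = "{p \<in> P. p \<le> x}" and ?B = "{p \<in> P. x < p}"
  have A: "finite ?A" "?A \<noteq> {}" and B: "finite ?B" "?B \<noteq> {}" using P assms by auto
  show "Max ?A \<in> P" "Max ?A \<le> x" using Max_in[OF A] by auto
  show "Min ?B \<in> P" "x < Min ?B" using Min_in[OF B] by auto
  have "p \<le> Max ?A \<or> Min ?B \<le> p" if "p \<in> P" for p
    using that Max_ge[OF A(1), of p] Min_le[OF B(1), of p] by (cases "p \<le> x") auto
  then show "{Max ?A<..<Min ?B} \<inter> P = {}" by force
qed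

text \<open>The point \<open>p\<close> may be an end of the piece: a derivative within a
  nondegenerate closed interval is still unique there.\<close>

lemma affine_has_derivative_unique:
  fixes g :: "real \<Rightarrow> real"
  assumes "(g has_real_derivative D) (at p within {0..1})" "0 \<le> a" "a < b" "b \<le> 1" "p \<in> {a..b}"
    "\<forall>x\<in>{a..b}. g x = m * x + c"
  shows "D = m"
proof -
  have "(g has_real_derivative D) (at p within {a..b})"
    using assms(1) by (rule DERIV_subset) (use assms in auto)
  moreover have "((\<lambda>x. m * x + c) has_real_derivative m) (at p within {a..b})"
    by (auto intro!: derivative_eq_intros)
  then have "(g has_real_derivative m) (at p within {a..b})"
    by (rule has_field_derivative_transform_within[of _ _ _ _ 1]) (use assms in auto)
  ultimately show ?thesis
    using vector_derivative_unique_within_closed_interval[of a b p g D m] assms(3,5)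
    by (simp add: has_real_derivative_iff_has_vector_derivative)
qed

text \<open>The pieces on both sides of \<open>p\<close> have the derivative at \<open>p\<close> as
  their slope and agree at \<open>p\<close>, so they merge into one.\<close>

lemma affine_partition_remove:
  assumes P: "affine_partition g P" and p: "p \<in> P" "p \<noteq> 0" "p \<noteq> 1"
    and diff: "g differentiable (at p within {0..1})"
  shows "affine_partition g (P - {p})"
proof -
  have sub: "finite P" "{0, 1} \<subseteq> P" "P \<subseteq> {0..1}"
    and aff: "\<And>a b. a \<in> P \<Longrightarrow> b \<in> P \<Longrightarrow> a < b \<Longrightarrow> {a<..<b} \<inter> P = {} \<Longrightarrow> \<exists>m c. \<forall>x\<in>{a..b}. g x = m * x + c"
    using P by (auto simp: affine_partition_def)
  obtain D where D: "(g has_real_derivative D) (at p within {0..1})"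
    using diff real_differentiable_def by blast
  have "\<exists>m c. \<forall>x\<in>{a..b}. g x = m * x + c"
    if ab: "a \<in> P" "b \<in> P" "a \<noteq> p" "b \<noteq> p" "a < b" "{a<..<b} \<inter> (P - {p}) = {}" for a b
  proof (cases "p \<in> {a<..<b}")
    case False
    then have "{a<..<b} \<inter> P = {}" using ab(6) by blast
    then show ?thesis by (rule aff[OF ab(1,2,5)])
  next
    case True
    have "x \<notin> P" if "a < x" "x < b" "x \<noteq> p" for x using ab(6) that by auto
    then have gaps: "{a<..<p} \<inter> P = {}" "{p<..<b} \<inter> P = {}" using True by auto
    obtain m c where 1: "\<forall>x\<in>{a..p}. g x = m * x + c"
      using aff[OF ab(1) p(1) _ gaps(1)] True by auto
    obtain m' c' where 2: "\<forall>x\<in>{p..b}. g x = m' * x + c'"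
      using aff[OF p(1) ab(2) _ gaps(2)] True by auto
    have "0 \<le> a" "b \<le> 1" using ab sub by auto
    have "D = m" using D True \<open>0 \<le> a\<close> \<open>b \<le> 1\<close> by (intro affine_has_derivative_unique[OF D _ _ _ _ 1]) auto
    moreover have "D = m'" using D True \<open>0 \<le> a\<close> \<open>b \<le> 1\<close> by (intro affine_has_derivative_unique[OF D _ _ _ _ 2]) auto
    ultimately have "m' = m" by simp
    moreover have "m * p + c = m' * p + c'" using 1 2 True by (metis atLeastAtMost_iff greaterThanLessThan_iff less_imp_le order_refl)
    ultimately have "\<forall>x\<in>{a..b}. g x = m * x + c"
      using 1 2 by (metis add_left_cancel atLeastAtMost_iff linorder_le_cases)
    then show ?thesis by blast
  qed
  then show ?thesis using sub p unfolding affine_partition_def by auto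
qed

lemma dyadic_common:
  assumes "finite P" "\<forall>p\<in>P. dyadic p"
  shows "\<exists>M::nat. \<forall>p\<in>P. \<exists>z::int. p = z / 2 ^ M"
  using assms
proof (induction P)
  case (insert p P)
  then obtain M :: nat where M: "\<forall>p\<in>P. \<exists>z::int. p = z / 2 ^ M" by auto
  obtain z :: int and N :: nat where z: "p = z / 2 ^ N" using insert.prems by (auto simp: dyadic_def)
  have "\<exists>z::int. x = z / 2 ^ (M + N)" if x: "x \<in> insert p P" for x
  proof (cases "x = p")
    case True
    then show ?thesis using z by (intro exI[of _ "z * 2 ^ M"]) (simp add: power_add)
  next
    case False
    then obtain y :: int where "x = y / 2 ^ M" using x M by auto
    then show ?thesis by (intro exI[of _ "y * 2 ^ N"]) (simp add: power_add)
  qed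
  then show ?case by blast
qed simp

lemma powi_dyadic_step:
  fixes k :: int
  assumes "\<bar>m\<bar> = 2 powi k"
  shows "dyadic_step (m / 2 ^ M)"
proof (cases "0 \<le> k")
  case True
  then show ?thesis using assms unfolding dyadic_step_def
    by (intro exI[of _ "nat k"] exI[of _ M]) (simp add: power_int_def)
next
  case False
  then show ?thesis using assms unfolding dyadic_step_def
    by (intro exI[of _ 0] exI[of _ "nat (- k) + M"]) (simp add: power_int_def power_add field_simps)
qed

text \<open>In a partition with the fewest points every point other than 0 and 1 is a point of
  non-differentiability, since it could be removed otherwise. All points are then dyadic, and a
  common denominator \<open>2 ^ M\<close> gives a grid refining the partition.\<close>

lemma thompson_monoid_grid:
  assumes "g \<in> thompson_monoid"
  shows "\<exists>M::nat. \<forall>j<2 ^ M. \<exists>m c. (\<forall>x\<in>{real j / 2 ^ M..real (Suc j) / 2 ^ M}. g x = m * x + c) \<and>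
    dyadic_step (m / 2 ^ M)"
proof -
  let ?Q = "affine_partition g"
  have "\<exists>P. ?Q P" using assms by (auto simp: thompson_monoid_def piecewise_affine_def affine_partition_def)
  then obtain P where P: "?Q P" and min: "\<And>P'. ?Q P' \<Longrightarrow> card P \<le> card P'"
    using ex_has_least_nat[of ?Q _ card] by blast
  have sub: "finite P" "0 \<in> P" "1 \<in> P" "P \<subseteq> {0..1}" using P by (auto simp: affine_partition_def)
  have "dyadic p" if p: "p \<in> P" for p
  proof (cases "p = 0 \<or> p = 1")
    case True
    then show ?thesis unfolding dyadic_def
      by (metis div_by_1 of_int_0 of_int_1 power_0)
  next
    case False
    have "\<not> g differentiable (at p within {0..1})"
    proof
      assume "g differentiable (at p within {0..1})"
      then have "card P \<le> card (P - {p})"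
        using min affine_partition_remove[OF P p] False by blast
      then show False using p sub(1) by (meson card_Diff1_less leD)
    qed
    then show ?thesis using assms p sub by (auto simp: thompson_monoid_def nondiff_points_def)
  qed
  then obtain M :: nat where M: "\<forall>p\<in>P. \<exists>z::int. p = z / 2 ^ M" using dyadic_common sub(1) by blast
  have "\<exists>m c. (\<forall>x\<in>{real j / 2 ^ M..real (Suc j) / 2 ^ M}. g x = m * x + c) \<and> dyadic_step (m / 2 ^ M)"
    if j: "j < 2 ^ M" for j
  proof -
    let ?x = "real j / 2 ^ M"
    have "real j < 2 ^ M" using j by (metis of_nat_less_iff of_nat_numeral of_nat_power)
    then have x: "0 \<le> ?x" "?x < 1" by auto
    obtain a b where ab: "a \<in> P" "b \<in> P" "a \<le> ?x" "?x < b" "{a<..<b} \<inter> P = {}"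
      using affine_partition_neighbours[OF P x] .
    have lt: "a < b" using ab by simp
    obtain m c where mc: "\<forall>x\<in>{a..b}. g x = m * x + c"
      using P ab lt unfolding affine_partition_def by blast
    obtain z :: int where z: "b = z / 2 ^ M" using M ab(2) by blast
    \<comment> \<open>\<open>b\<close> is itself a grid point to the right of \<open>?x\<close>, so
      the next grid point does not pass it.\<close>
    have "real j < z" using ab(4) unfolding z by (simp add: field_simps)
    then have "int j + 1 \<le> z" by linarith
    then have "real (Suc j) \<le> z" by linarith
    then have "real (Suc j) / 2 ^ M \<le> b" unfolding z by (intro divide_right_mono) auto
    then have g: "\<forall>x\<in>{?x..real (Suc j) / 2 ^ M}. g x = m * x + c" using mc ab by auto
    have der: "(g has_real_derivative m) (at x)" if x: "x \<in> {a<..<b}" for x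
    proof -
      have "((\<lambda>x. m * x + c) has_real_derivative m) (at x)" by (auto intro!: derivative_eq_intros)
      then show ?thesis
        by (rule has_field_derivative_transform_within_open[of _ _ _ "{a<..<b}"]) (use x mc in auto)
    qed
    then have "g differentiable_on {a<..<b}"
      unfolding differentiable_on_def by (meson differentiable_at_withinI real_differentiable_def)
    moreover have "0 \<le> a" "b \<le> 1" using ab sub by auto
    ultimately have "\<forall>x\<in>{a<..<b}. \<exists>k::int. deriv g x = 2 powi k \<or> deriv g x = - (2 powi k)"
      using assms lt unfolding thompson_monoid_def by blast
    moreover have mid: "(a + b) / 2 \<in> {a<..<b}" using lt by auto
    ultimately obtain k :: int where "m = 2 powi k \<or> m = - (2 powi k)"
      using DERIV_imp_deriv[OF der[OF mid]] by metis
    then have "\<bar>m\<bar> = 2 powi k" by auto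
    then show ?thesis using g powi_dyadic_step by blast
  qed
  then show ?thesis by blast
qed

text \<open>Composing \<open>g\<close> with the group element \<open>polyline ?q ?n\<close> gives
  the polyline through the values of \<open>g\<close> on the grid. Thus \<open>g\<close> is
  equivalent to a polyline with dyadic increments and the same image.\<close>

lemma thompson_monoid_subset_generated:
  assumes "g \<in> thompson_monoid"
  shows "g \<in> generated"
proof -
  obtain M :: nat where M: "\<And>j. j < 2 ^ M \<Longrightarrow> \<exists>m c. (\<forall>x\<in>{real j / 2 ^ M..real (Suc j) / 2 ^ M}. g x = m * x + c) \<and>
    dyadic_step (m / 2 ^ M)" using thompson_monoid_grid[OF assms] by blast
  let ?q = "\<lambda>j. real j / 2 ^ M" and ?n = "2 ^ M :: nat"
  have step: "?q (Suc i) - ?q i = 1 / 2 ^ M" for i by (simp add: diff_divide_distrib[symmetric])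
  have q_F: "polyline ?q ?n \<in> thompson_F"
    by (intro polyline_in_F) (auto simp: dyadic_step_def diff_divide_distrib[symmetric] intro: exI[of _ 0])
  have gq: "g (polyline ?q ?n x) = polyline (\<lambda>j. g (?q j)) ?n x" if "x \<in> {0..1}" for x
  proof (rule comp_polyline)
    fix i and t :: real assume i: "i < ?n" and t: "t \<in> {0..1}"
    obtain m c where g: "\<forall>x\<in>{?q i..?q (Suc i)}. g x = m * x + c" using M[OF i] by blast
    have "0 \<le> t / 2 ^ M" "t / 2 ^ M \<le> 1 / 2 ^ M" using t by (auto intro: divide_right_mono)
    then have "?q i + (?q (Suc i) - ?q i) * t \<in> {?q i..?q (Suc i)}"
      using step[of i] unfolding step by (simp add: add_divide_distrib)
    moreover have "?q i \<in> {?q i..?q (Suc i)}" "?q (Suc i) \<in> {?q i..?q (Suc i)}"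
      by (auto intro: divide_right_mono)
    ultimately show "g (?q i + (?q (Suc i) - ?q i) * t) = g (?q i) + (g (?q (Suc i)) - g (?q i)) * t"
      using g by (simp only:) (simp only: algebra_simps)
  qed (use that in auto)
  have eq: "g \<doteq> polyline (\<lambda>j. g (?q j)) ?n"
    by (rule fequiv_sym, rule fequivI[OF q_F]) (simp only: gq)
  have "polyline (\<lambda>j. g (?q j)) ?n \<in> generated"
  proof (rule dyadic_polyline_in_generated)
    show "dyadic_step (g (?q (Suc i)) - g (?q i))" if i: "i < ?n" for i
    proof -
      obtain m c where g: "\<forall>x\<in>{?q i..?q (Suc i)}. g x = m * x + c" "dyadic_step (m / 2 ^ M)"
        using M[OF i] by blast
      have "?q i \<in> {?q i..?q (Suc i)}" "?q (Suc i) \<in> {?q i..?q (Suc i)}"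
        by (auto intro: divide_right_mono)
      then have "g (?q (Suc i)) - g (?q i) = m * (?q (Suc i) - ?q i)"
        using g(1) by (simp only:) (simp only: algebra_simps)
      then show ?thesis using g(2) unfolding step by simp
    qed
    have "polyline ?q ?n ` {0..1} = {0..1}" by (rule F_image[OF q_F])
    moreover have "g ` {0..1} = {0..1}" using assms by (simp add: thompson_monoid_def)
    moreover have "polyline (\<lambda>j. g (?q j)) ?n ` {0..1} = g ` polyline ?q ?n ` {0..1}"
      unfolding image_image by (intro image_cong) (simp_all only: gq)
    ultimately show "polyline (\<lambda>j. g (?q j)) ?n ` {0..1} = {0..1}" by simp
  qed simp
  with eq show ?thesis by (rule generated_fequiv)
qed

theorem theorem33:
  fixes g :: "real \<Rightarrow> real"
  assumes "g \<in> thompson_monoid"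
  shows "\<exists>fs. fs \<noteq> [] \<and> set fs \<subseteq> generator_maps \<and>
           (\<forall>x\<in>{0..1}. g x = foldr (\<circ>) fs id x)"
proof -
  obtain fs where "set fs \<subseteq> generator_maps" "\<forall>x\<in>{0..1}. g x = foldr (\<circ>) fs id x"
    using thompson_monoid_subset_generated[OF assms] unfolding generated_def by blast
  \<comment> \<open>\<open>g0_plus\<close> as innermost factor makes the list nonempty without
    changing the product.\<close>
  moreover have "foldr (\<circ>) [g0_plus] id x = x" for x
    by (simp add: g0_plus_def)
  ultimately show ?thesis
    by (intro exI[of _ "fs @ [g0_plus]"]) (simp add: foldr_comp_append generator_maps_def del: foldr.simps foldr_append)
qed

end
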